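(* The following is provable in $\mathrm{HA}^\omega$ together with the defining equation of $\mathsf{eps}$. For any $q\colon X^{\mathbb{N}}\to R$, any $\omega\colon X^{\mathbb{N}}\to\mathbb{N}$ and any sequence of selection functions $\varepsilon_n\colon J_RX$ ($n\in\mathbb{N}$, of common type $J_RX$), there are $n\colon\mathbb{N}$, $\alpha\colon\mathbb{N}\to X$ and $p\colon X\to R$ satisfying Spector's system of equations $$n=\omega(\alpha),\qquad \alpha(n)=\varepsilon_n(p),\qquad p(\alpha(n))=q(\alpha).$$
   Context: $X,R$ are arbitrary finite types (generated from booleans $\mathbb{B}$ and $\mathbb{N}$ by products, function types and finite sequence types); $X^{\mathbb{N}}$ is $\mathbb{N}\to X$. $\mathrm{HA}^\omega$ is Heyting arithmetic in all finite types with fully extensional equality (Troelstra's E-$\mathrm{HA}^\omega$). $J_RX=(X\to R)\to X$. $\mathbf{0}$ is the canonical zero object of each type. $*$ is concatenation, $q_x(\beta)=q(x*\beta)$. $\mathsf{eps}$ (available at all finite types $X$, $R$). For $\varepsilon\colon\mathbb{N}\to J_RX$, $\ell\colon R\to\mathbb{N}$, $n\colon\mathbb{N}$, $q\colon X^{\mathbb{N}}\to R$, the value $\mathsf{eps}^\ell_n(\varepsilon)(q)\colon X^{\mathbb{N}}$ is specified by: $\mathsf{eps}^\ell_n(\varepsilon)(q)=\mathbf{0}$ if $\ell(q(\mathbf{0}))<n$, and otherwise $\mathsf{eps}^\ell_n(\varepsilon)(q)=c*\mathsf{eps}^\ell_{n+1}(\varepsilon)(q_c)$, where $c=\varepsilon_n(\lambda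 x.\,q_x(\mathsf{eps}^\ell_{n+1}(\varepsilon)(q_x)))$. *)

theory Defs
  imports Main
begin

section \<open>Heyting arithmetic in all finite types, with extensional equality\<close>

text \<open>
  A deep embedding of E-HA-omega as an intuitionistic natural deduction calculus over the simply
  typed lambda calculus. Binders use de Bruijn indices. Substitutions are parallel: they map
  every index to a term.
\<close>

datatype ty =
    BoolT
  | NatT
  | ProdT ty ty
  | FunT ty ty  (infixr "\<rightarrow>" 60)
  | SeqT ty

text \<open>
  \<open>RecC \<tau>\<close> and \<open>SRecC \<sigma> \<tau>\<close> are the primitive recursors on numbers and on finite sequences.
  \<open>EpsC X R\<close> belongs to the language only: it is governed by no rule of the calculus, and its
  defining equation is supplied as a non-logical axiom below.
\<close>

datatype const =
    TrueC | FalseC | IfC ty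
  | ZeroC | SuccC | RecC ty
  | PairC ty ty | FstC ty ty | SndC ty ty
  | NilC ty | ConsC ty | SRecC ty ty
  | EpsC ty ty

abbreviation (input) J :: "ty \<Rightarrow> ty \<Rightarrow> ty" where
  "J R X \<equiv> (X \<rightarrow> R) \<rightarrow> X"

primrec const_type :: "const \<Rightarrow> ty" where
  "const_type TrueC = BoolT"
| "const_type FalseC = BoolT"
| "const_type (IfC \<tau>) = (BoolT \<rightarrow> \<tau> \<rightarrow> \<tau> \<rightarrow> \<tau>)"
| "const_type ZeroC = NatT"
| "const_type SuccC = (NatT \<rightarrow> NatT)"
| "const_type (RecC \<tau>) = (\<tau> \<rightarrow> (NatT \<rightarrow> \<tau> \<rightarrow> \<tau>) \<rightarrow> NatT \<rightarrow> \<tau>)"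
| "const_type (PairC \<sigma> \<tau>) = (\<sigma> \<rightarrow> \<tau> \<rightarrow> ProdT \<sigma> \<tau>)"
| "const_type (FstC \<sigma> \<tau>) = (ProdT \<sigma> \<tau> \<rightarrow> \<sigma>)"
| "const_type (SndC \<sigma> \<tau>) = (ProdT \<sigma> \<tau> \<rightarrow> \<tau>)"
| "const_type (NilC \<sigma>) = SeqT \<sigma>"
| "const_type (ConsC \<sigma>) = (\<sigma> \<rightarrow> SeqT \<sigma> \<rightarrow> SeqT \<sigma>)"
| "const_type (SRecC \<sigma> \<tau>) = (\<tau> \<rightarrow> (\<sigma> \<rightarrow> SeqT \<sigma> \<rightarrow> \<tau> \<rightarrow> \<tau>) \<rightarrow> SeqT \<sigma> \<rightarrow> \<tau>)"
| "const_type (EpsC X R) =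
     ((R \<rightarrow> NatT) \<rightarrow> NatT \<rightarrow> (NatT \<rightarrow> J R X) \<rightarrow> ((NatT \<rightarrow> X) \<rightarrow> R) \<rightarrow> (NatT \<rightarrow> X))"

datatype tm =
    Var nat
  | Con const
  | App tm tm  (infixl "\<cdot>" 100)
  | Lam ty tm

text \<open>A typing context lists the types of the free variables: index \<open>i\<close> has type \<open>\<Gamma> ! i\<close>.\<close>

inductive has_type :: "ty list \<Rightarrow> tm \<Rightarrow> ty \<Rightarrow> bool" where
  "i < length \<Gamma> \<Longrightarrow> has_type \<Gamma> (Var i) (\<Gamma> ! i)"
| "has_type \<Gamma> (Con c) (const_type c)"
| "has_type \<Gamma> s (\<sigma> \<rightarrow> \<tau>) \<Longrightarrow> has_type \<Gamma> t \<sigma> \<Longrightarrow> has_type \<Gamma> (s \<cdot> t) \<tau>"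
| "has_type (\<sigma> # \<Gamma>) t \<tau> \<Longrightarrow> has_type \<Gamma> (Lam \<sigma> t) (\<sigma> \<rightarrow> \<tau>)"

primrec ren :: "(nat \<Rightarrow> nat) \<Rightarrow> tm \<Rightarrow> tm" where
  "ren \<rho> (Var i) = Var (\<rho> i)"
| "ren \<rho> (Con c) = Con c"
| "ren \<rho> (s \<cdot> t) = ren \<rho> s \<cdot> ren \<rho> t"
| "ren \<rho> (Lam \<sigma> t) = Lam \<sigma> (ren (case_nat 0 (Suc \<circ> \<rho>)) t)"

abbreviation lift :: "tm \<Rightarrow> tm" where
  "lift \<equiv> ren Suc"

definition under_binder :: "(nat \<Rightarrow> tm) \<Rightarrow> nat \<Rightarrow> tm" where
  "under_binder \<theta> = case_nat (Var 0) (lift \<circ> \<theta>)"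

primrec subst :: "(nat \<Rightarrow> tm) \<Rightarrow> tm \<Rightarrow> tm" where
  "subst \<theta> (Var i) = \<theta> i"
| "subst \<theta> (Con c) = Con c"
| "subst \<theta> (s \<cdot> t) = subst \<theta> s \<cdot> subst \<theta> t"
| "subst \<theta> (Lam \<sigma> t) = Lam \<sigma> (subst (under_binder \<theta>) t)"

abbreviation inst :: "tm \<Rightarrow> tm \<Rightarrow> tm" where
  "inst u t \<equiv> subst (case_nat u Var) t"

datatype fm =
    Bot
  | Eq ty tm tm
  | And fm fm
  | Or fm fm
  | Imp fm fm
  | Forall ty fm
  | Exists ty fm

primrec wff :: "ty list \<Rightarrow> fm \<Rightarrow> bool" where
  "wff \<Gamma> Bot \<longleftrightarrow> True"
| "wff \<Gamma> (Eq \<tau> s t) \<longleftrightarrow> has_type \<Gamma> s \<tau> \<and> has_type \<Gamma> t \<tau>"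
| "wff \<Gamma> (And \<phi> \<psi>) \<longleftrightarrow> wff \<Gamma> \<phi> \<and> wff \<Gamma> \<psi>"
| "wff \<Gamma> (Or \<phi> \<psi>) \<longleftrightarrow> wff \<Gamma> \<phi> \<and> wff \<Gamma> \<psi>"
| "wff \<Gamma> (Imp \<phi> \<psi>) \<longleftrightarrow> wff \<Gamma> \<phi> \<and> wff \<Gamma> \<psi>"
| "wff \<Gamma> (Forall \<tau> \<phi>) \<longleftrightarrow> wff (\<tau> # \<Gamma>) \<phi>"
| "wff \<Gamma> (Exists \<tau> \<phi>) \<longleftrightarrow> wff (\<tau> # \<Gamma>) \<phi>"

primrec fsubst :: "(nat \<Rightarrow> tm) \<Rightarrow> fm \<Rightarrow> fm" where
  "fsubst \<theta> Bot = Bot"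
| "fsubst \<theta> (Eq \<tau> s t) = Eq \<tau> (subst \<theta> s) (subst \<theta> t)"
| "fsubst \<theta> (And \<phi> \<psi>) = And (fsubst \<theta> \<phi>) (fsubst \<theta> \<psi>)"
| "fsubst \<theta> (Or \<phi> \<psi>) = Or (fsubst \<theta> \<phi>) (fsubst \<theta> \<psi>)"
| "fsubst \<theta> (Imp \<phi> \<psi>) = Imp (fsubst \<theta> \<phi>) (fsubst \<theta> \<psi>)"
| "fsubst \<theta> (Forall \<tau> \<phi>) = Forall \<tau> (fsubst (under_binder \<theta>) \<phi>)"
| "fsubst \<theta> (Exists \<tau> \<phi>) = Exists \<tau> (fsubst (under_binder \<theta>) \<phi>)"

abbreviation finst :: "tm \<Rightarrow> fm \<Rightarrow> fm" where
  "finst u \<phi> \<equiv> fsubst (case_nat u Var) \<phi>"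

abbreviation flift :: "fm \<Rightarrow> fm" where
  "flift \<equiv> fsubst (\<lambda>i. Var (Suc i))"

text \<open>
  \<open>HA T \<Gamma> \<Delta> \<phi>\<close>: in the typing context \<open>\<Gamma>\<close>, the formula \<open>\<phi>\<close> is derivable from the assumptions
  \<open>\<Delta>\<close> in the calculus extended by the sentences in \<open>T\<close> as axioms. The side conditions on types
  ensure that only well-formed formulas are derivable; in particular beta conversion is
  restricted to typed terms. Equality is primitive at every type. The rule \<open>ext\<close> makes it fully
  extensional, and yields eta conversion and congruence under lambda.
\<close>

inductive HA :: "fm set \<Rightarrow> ty list \<Rightarrow> fm list \<Rightarrow> fm \<Rightarrow> bool" for T :: "fm set" where
  ax: "\<phi> \<in> T \<Longrightarrow> wff [] \<phi> \<Longrightarrow> HA T \<Gamma> \<Delta> \<phi>"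
| asm: "\<phi> \<in> set \<Delta> \<Longrightarrow> wff \<Gamma> \<phi> \<Longrightarrow> HA T \<Gamma> \<Delta> \<phi>"
| botE: "HA T \<Gamma> \<Delta> Bot \<Longrightarrow> wff \<Gamma> \<phi> \<Longrightarrow> HA T \<Gamma> \<Delta> \<phi>"
| andI: "HA T \<Gamma> \<Delta> \<phi> \<Longrightarrow> HA T \<Gamma> \<Delta> \<psi> \<Longrightarrow> HA T \<Gamma> \<Delta> (And \<phi> \<psi>)"
| andE1: "HA T \<Gamma> \<Delta> (And \<phi> \<psi>) \<Longrightarrow> HA T \<Gamma> \<Delta> \<phi>"
| andE2: "HA T \<Gamma> \<Delta> (And \<phi> \<psi>) \<Longrightarrow> HA T \<Gamma> \<Delta> \<psi>"
| orI1: "HA T \<Gamma> \<Delta> \<phi> \<Longrightarrow> wff \<Gamma> \<psi> \<Longrightarrow> HA T \<Gamma> \<Delta> (Or \<phi> \<psi>)"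
| orI2: "HA T \<Gamma> \<Delta> \<psi> \<Longrightarrow> wff \<Gamma> \<phi> \<Longrightarrow> HA T \<Gamma> \<Delta> (Or \<phi> \<psi>)"
| orE: "HA T \<Gamma> \<Delta> (Or \<phi> \<psi>) \<Longrightarrow> HA T \<Gamma> (\<phi> # \<Delta>) \<chi> \<Longrightarrow> HA T \<Gamma> (\<psi> # \<Delta>) \<chi> \<Longrightarrow> HA T \<Gamma> \<Delta> \<chi>"
| impI: "wff \<Gamma> \<phi> \<Longrightarrow> HA T \<Gamma> (\<phi> # \<Delta>) \<psi> \<Longrightarrow> HA T \<Gamma> \<Delta> (Imp \<phi> \<psi>)"
| impE: "HA T \<Gamma> \<Delta> (Imp \<phi> \<psi>) \<Longrightarrow> HA T \<Gamma> \<Delta> \<phi> \<Longrightarrow> HA T \<Gamma> \<Delta> \<psi>"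
| allI: "HA T (\<tau> # \<Gamma>) (map flift \<Delta>) \<phi> \<Longrightarrow> HA T \<Gamma> \<Delta> (Forall \<tau> \<phi>)"
| allE: "HA T \<Gamma> \<Delta> (Forall \<tau> \<phi>) \<Longrightarrow> has_type \<Gamma> t \<tau> \<Longrightarrow> HA T \<Gamma> \<Delta> (finst t \<phi>)"
| exI: "wff (\<tau> # \<Gamma>) \<phi> \<Longrightarrow> has_type \<Gamma> t \<tau> \<Longrightarrow> HA T \<Gamma> \<Delta> (finst t \<phi>)
    \<Longrightarrow> HA T \<Gamma> \<Delta> (Exists \<tau> \<phi>)"
| exE: "HA T \<Gamma> \<Delta> (Exists \<tau> \<phi>) \<Longrightarrow> wff \<Gamma> \<psi> \<Longrightarrow> HA T (\<tau> # \<Gamma>) (\<phi> # map flift \<Delta>) (flift \<psi>)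
    \<Longrightarrow> HA T \<Gamma> \<Delta> \<psi>"
| refl: "has_type \<Gamma> t \<tau> \<Longrightarrow> HA T \<Gamma> \<Delta> (Eq \<tau> t t)"
| repl: "wff (\<tau> # \<Gamma>) \<phi> \<Longrightarrow> HA T \<Gamma> \<Delta> (Eq \<tau> s t) \<Longrightarrow> HA T \<Gamma> \<Delta> (finst s \<phi>)
    \<Longrightarrow> HA T \<Gamma> \<Delta> (finst t \<phi>)"
| ext: "has_type \<Gamma> f (\<sigma> \<rightarrow> \<tau>) \<Longrightarrow> has_type \<Gamma> g (\<sigma> \<rightarrow> \<tau>)
    \<Longrightarrow> HA T \<Gamma> \<Delta> (Forall \<sigma> (Eq \<tau> (lift f \<cdot> Var 0) (lift g \<cdot> Var 0)))
    \<Longrightarrow> HA T \<Gamma> \<Delta> (Eq (\<sigma> \<rightarrow> \<tau>) f g)"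
| beta: "has_type (\<sigma> # \<Gamma>) t \<tau> \<Longrightarrow> has_type \<Gamma> u \<sigma>
    \<Longrightarrow> HA T \<Gamma> \<Delta> (Eq \<tau> (Lam \<sigma> t \<cdot> u) (inst u t))"
| if_true: "has_type \<Gamma> s \<tau> \<Longrightarrow> has_type \<Gamma> t \<tau>
    \<Longrightarrow> HA T \<Gamma> \<Delta> (Eq \<tau> (Con (IfC \<tau>) \<cdot> Con TrueC \<cdot> s \<cdot> t) s)"
| if_false: "has_type \<Gamma> s \<tau> \<Longrightarrow> has_type \<Gamma> t \<tau>
    \<Longrightarrow> HA T \<Gamma> \<Delta> (Eq \<tau> (Con (IfC \<tau>) \<cdot> Con FalseC \<cdot> s \<cdot> t) t)"
| bool_cases: "wff (BoolT # \<Gamma>) \<phi>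
    \<Longrightarrow> HA T \<Gamma> \<Delta> (finst (Con TrueC) \<phi>) \<Longrightarrow> HA T \<Gamma> \<Delta> (finst (Con FalseC) \<phi>)
    \<Longrightarrow> HA T \<Gamma> \<Delta> (Forall BoolT \<phi>)"
| zero_not_succ: "HA T \<Gamma> \<Delta> (Eq NatT (Con ZeroC) (Con SuccC \<cdot> t)) \<Longrightarrow> HA T \<Gamma> \<Delta> Bot"
| succ_inj: "has_type \<Gamma> s NatT \<Longrightarrow> has_type \<Gamma> t NatT
    \<Longrightarrow> HA T \<Gamma> \<Delta> (Eq NatT (Con SuccC \<cdot> s) (Con SuccC \<cdot> t)) \<Longrightarrow> HA T \<Gamma> \<Delta> (Eq NatT s t)"
| rec_zero: "has_type \<Gamma> a \<tau> \<Longrightarrow> has_type \<Gamma> f (NatT \<rightarrow> \<tau> \<rightarrow> \<tau>)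
    \<Longrightarrow> HA T \<Gamma> \<Delta> (Eq \<tau> (Con (RecC \<tau>) \<cdot> a \<cdot> f \<cdot> Con ZeroC) a)"
| rec_succ: "has_type \<Gamma> a \<tau> \<Longrightarrow> has_type \<Gamma> f (NatT \<rightarrow> \<tau> \<rightarrow> \<tau>) \<Longrightarrow> has_type \<Gamma> n NatT
    \<Longrightarrow> HA T \<Gamma> \<Delta> (Eq \<tau> (Con (RecC \<tau>) \<cdot> a \<cdot> f \<cdot> (Con SuccC \<cdot> n))
                        (f \<cdot> n \<cdot> (Con (RecC \<tau>) \<cdot> a \<cdot> f \<cdot> n)))"
| nat_induct: "wff (NatT # \<Gamma>) \<phi> \<Longrightarrow> HA T \<Gamma> \<Delta> (finst (Con ZeroC) \<phi>)
    \<Longrightarrow> HA T \<Gamma> \<Delta>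
          (Forall NatT (Imp \<phi> (fsubst (case_nat (Con SuccC \<cdot> Var 0) (\<lambda>i. Var (Suc i))) \<phi>)))
    \<Longrightarrow> HA T \<Gamma> \<Delta> (Forall NatT \<phi>)"
| fst_pair: "has_type \<Gamma> s \<sigma> \<Longrightarrow> has_type \<Gamma> t \<tau>
    \<Longrightarrow> HA T \<Gamma> \<Delta> (Eq \<sigma> (Con (FstC \<sigma> \<tau>) \<cdot> (Con (PairC \<sigma> \<tau>) \<cdot> s \<cdot> t)) s)"
| snd_pair: "has_type \<Gamma> s \<sigma> \<Longrightarrow> has_type \<Gamma> t \<tau>
    \<Longrightarrow> HA T \<Gamma> \<Delta> (Eq \<tau> (Con (SndC \<sigma> \<tau>) \<cdot> (Con (PairC \<sigma> \<tau>) \<cdot> s \<cdot> t)) t)"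
| pair_surj: "has_type \<Gamma> t (ProdT \<sigma> \<tau>)
    \<Longrightarrow> HA T \<Gamma> \<Delta> (Eq (ProdT \<sigma> \<tau>)
          (Con (PairC \<sigma> \<tau>) \<cdot> (Con (FstC \<sigma> \<tau>) \<cdot> t) \<cdot> (Con (SndC \<sigma> \<tau>) \<cdot> t)) t)"
| srec_nil: "has_type \<Gamma> a \<tau> \<Longrightarrow> has_type \<Gamma> f (\<sigma> \<rightarrow> SeqT \<sigma> \<rightarrow> \<tau> \<rightarrow> \<tau>)
    \<Longrightarrow> HA T \<Gamma> \<Delta> (Eq \<tau> (Con (SRecC \<sigma> \<tau>) \<cdot> a \<cdot> f \<cdot> Con (NilC \<sigma>)) a)"
| srec_cons: "has_type \<Gamma> a \<tau> \<Longrightarrow> has_type \<Gamma> f (\<sigma> \<rightarrow> SeqT \<sigma> \<rightarrow> \<tau> \<rightarrow> \<tau>)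
    \<Longrightarrow> has_type \<Gamma> x \<sigma> \<Longrightarrow> has_type \<Gamma> s (SeqT \<sigma>)
    \<Longrightarrow> HA T \<Gamma> \<Delta> (Eq \<tau> (Con (SRecC \<sigma> \<tau>) \<cdot> a \<cdot> f \<cdot> (Con (ConsC \<sigma>) \<cdot> x \<cdot> s))
                        (f \<cdot> x \<cdot> s \<cdot> (Con (SRecC \<sigma> \<tau>) \<cdot> a \<cdot> f \<cdot> s)))"
| seq_induct: "wff (SeqT \<sigma> # \<Gamma>) \<phi> \<Longrightarrow> HA T \<Gamma> \<Delta> (finst (Con (NilC \<sigma>)) \<phi>)
    \<Longrightarrow> HA T \<Gamma> \<Delta>
          (Forall \<sigma> (Forall (SeqT \<sigma>)
            (Imp (fsubst (case_nat (Var 0) (\<lambda>i. Var (Suc (Suc i)))) \<phi>)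
                 (fsubst (case_nat (Con (ConsC \<sigma>) \<cdot> Var 1 \<cdot> Var 0) (\<lambda>i. Var (Suc (Suc i)))) \<phi>))))
    \<Longrightarrow> HA T \<Gamma> \<Delta> (Forall (SeqT \<sigma>) \<phi>)"


section \<open>The defining equation of \<open>eps\<close>\<close>

primrec zero :: "ty \<Rightarrow> tm" where
  "zero BoolT = Con FalseC"
| "zero NatT = Con ZeroC"
| "zero (ProdT \<sigma> \<tau>) = Con (PairC \<sigma> \<tau>) \<cdot> zero \<sigma> \<cdot> zero \<tau>"
| "zero (\<sigma> \<rightarrow> \<tau>) = Lam \<sigma> (zero \<tau>)"
| "zero (SeqT \<sigma>) = Con (NilC \<sigma>)"

text \<open>
  The remaining building blocks are closed terms, so they may be used under binders without
  lifting. The \<open>\<lambda>\<close>-terms they encode are, in order: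
  predecessor \<open>\<lambda>n. rec 0 (\<lambda>i r. i) n\<close>;
  truncated subtraction \<open>\<lambda>n m. rec n (\<lambda>i r. pred r) m\<close>;
  the strict order \<open>\<lambda>m n. rec false (\<lambda>i r. true) (n - m)\<close>, that is, whether \<open>n - m\<close> is nonzero;
  concatenation \<open>c * \<beta>\<close> as \<open>\<lambda>c \<beta> k. rec c (\<lambda>i r. \<beta> i) k\<close>;
  and \<open>q\<^sub>x\<close> as \<open>\<lambda>q x \<beta>. q (x * \<beta>)\<close>.
\<close>

definition pred_tm :: tm where
  "pred_tm = Lam NatT (Con (RecC NatT) \<cdot> Con ZeroC \<cdot> Lam NatT (Lam NatT (Var 1)) \<cdot> Var 0)"

definition minus_tm :: tm where
  "minus_tm = Lam NatT (Lam NatT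
     (Con (RecC NatT) \<cdot> Var 1 \<cdot> Lam NatT (Lam NatT (pred_tm \<cdot> Var 0)) \<cdot> Var 0))"

definition less_tm :: tm where
  "less_tm = Lam NatT (Lam NatT
     (Con (RecC BoolT) \<cdot> Con FalseC \<cdot> Lam NatT (Lam BoolT (Con TrueC)) \<cdot> (minus_tm \<cdot> Var 0 \<cdot> Var 1)))"

definition prepend :: "ty \<Rightarrow> tm" where
  "prepend X = Lam X (Lam (NatT \<rightarrow> X) (Lam NatT
     (Con (RecC X) \<cdot> Var 2 \<cdot> Lam NatT (Lam X (Var 3 \<cdot> Var 1)) \<cdot> Var 0)))"

definition section_tm :: "ty \<Rightarrow> ty \<Rightarrow> tm" where
  "section_tm X R = Lam ((NatT \<rightarrow> X) \<rightarrow> R) (Lam X (Lam (NatT \<rightarrow> X)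
     (Var 2 \<cdot> (prepend X \<cdot> Var 1 \<cdot> Var 0))))"

text \<open>
  Universal closure, in the variables \<open>\<epsilon>\<close> (index 3), \<open>\<ell>\<close> (2), \<open>n\<close> (1) and \<open>q\<close> (0), of
  \<open>eps \<ell> n \<epsilon> q = (if \<ell> (q 0) < n then 0 else c * eps \<ell> (n + 1) \<epsilon> q\<^sub>c)\<close>
  with \<open>c = \<epsilon> n (\<lambda>x. q\<^sub>x (eps \<ell> (n + 1) \<epsilon> q\<^sub>x))\<close>. In \<open>c\<close>, the binder for \<open>x\<close> raises
  the indices of the other variables by one.
\<close>

definition eps_equation :: "ty \<Rightarrow> ty \<Rightarrow> fm" where
  "eps_equation X R =
     Forall (NatT \<rightarrow> J R X) (Forall (R \<rightarrow> NatT) (Forall NatT (Forall ((NatT \<rightarrow> X) \<rightarrow> R)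
       (let q\<^sub>x = section_tm X R \<cdot> Var 1 \<cdot> Var 0;
            c = Var 3 \<cdot> Var 1 \<cdot>
                  Lam X (q\<^sub>x \<cdot> (Con (EpsC X R) \<cdot> Var 3 \<cdot> (Con SuccC \<cdot> Var 2) \<cdot> Var 4 \<cdot> q\<^sub>x));
            q\<^sub>c = section_tm X R \<cdot> Var 0 \<cdot> c
        in Eq (NatT \<rightarrow> X)
             (Con (EpsC X R) \<cdot> Var 2 \<cdot> Var 1 \<cdot> Var 3 \<cdot> Var 0)
             (Con (IfC (NatT \<rightarrow> X)) \<cdot> (less_tm \<cdot> (Var 2 \<cdot> (Var 0 \<cdot> zero (NatT \<rightarrow> X))) \<cdot> Var 1)
                \<cdot> zero (NatT \<rightarrow> X)
                \<cdot> (prepend X \<cdot> c \<cdot> (Con (EpsC X R) \<cdot> Var 2 \<cdot> (Con SuccC \<cdot> Var 1) \<cdot> Var 3 \<cdot> q\<^sub>c)))))))"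

definition eps_axioms :: "fm set" where
  "eps_axioms = {eps_equation X R | X R. True}"

text \<open>The rule \<open>ax\<close> admits only well-formed sentences; the defining equations qualify.\<close>

lemma has_type_Var: "i < length \<Gamma> \<Longrightarrow> \<Gamma> ! i = \<tau> \<Longrightarrow> has_type \<Gamma> (Var i) \<tau>"
  using has_type.intros(1) by blast

lemma has_type_Con: "const_type c = \<tau> \<Longrightarrow> has_type \<Gamma> (Con c) \<tau>"
  using has_type.intros(2) by blast

lemma has_type_zero: "has_type \<Gamma> (zero \<tau>) \<tau>"
  by (induction \<tau> arbitrary: \<Gamma>) (auto intro!: has_type.intros(3,4) has_type_Con)

lemma wff_eps_equation: "wff [] (eps_equation X R)"
  unfolding eps_equation_def Let_def less_tm_def minus_tm_def pred_tm_def section_tm_def prepend_def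
  by (simp del: zero.simps)
     (intro conjI; (rule has_type_zero has_type.intros(3,4) has_type_Var has_type_Con |
        simp add: numeral_eq_Suc)+)

end

theory Submission
  imports Defs
begin

text \<open>
  Let \<open>q' \<beta> = (q \<beta>, \<omega> \<beta>)\<close> with values in \<open>R \<times> \<nat>\<close>, let \<open>\<ell>\<close> be the second projection, let
  \<open>\<epsilon>'\<^sub>n p = \<epsilon>\<^sub>n (fst \<circ> p)\<close>, and let \<open>\<alpha> = eps \<ell> 0 \<epsilon>' q'\<close>. Write \<open>Q\<^sub>n\<close> for \<open>q'\<^sub>t\<close>, where \<open>t\<close> is the
  initial segment of \<open>\<alpha>\<close> of length \<open>n\<close>. By induction on \<open>n\<close>, \<open>eps \<ell> n \<epsilon>' Q\<^sub>n\<close> is the tail of \<open>\<alpha>\<close>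
  from \<open>n\<close> on, also past the stage where \<open>eps\<close> stops: from then on both sides are \<open>0\<close>, because
  \<open>Q\<^sub>n 0\<close> no longer changes and \<open>\<ell> (Q\<^sub>n 0) < n\<close> persists. Moreover \<open>Q\<^sub>n\<close> maps this tail to \<open>q' \<alpha>\<close>.
  At \<open>n = \<omega> \<alpha>\<close> the recursion cannot have stopped, since this would give \<open>\<omega> \<alpha> < n\<close>, and its unfolding
  there yields Spector's equations with \<open>p x = fst (Q x')\<close>, where \<open>Q = Q\<^sub>n\<close> and
  \<open>x' = x * eps \<ell> (n + 1) \<epsilon>' Q\<^sub>x\<close>.
\<close>

section \<open>Substitution and type inference\<close>

lemma ren_as_subst: "ren \<rho> t = subst (Var \<circ> \<rho>) t"
proof (induction t arbitrary: \<rho>)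
  case (Lam \<sigma> t)
  have "Var \<circ> case_nat 0 (Suc \<circ> \<rho>) = under_binder (Var \<circ> \<rho>)"
    by (auto simp: under_binder_def fun_eq_iff split: nat.split)
  then show ?case by (simp only: ren.simps subst.simps Lam)
qed auto

lemma subst_ren: "subst \<theta> (ren \<rho> t) = subst (\<theta> \<circ> \<rho>) t"
proof (induction t arbitrary: \<theta> \<rho>)
  case (Lam \<sigma> t)
  have "under_binder \<theta> \<circ> case_nat 0 (Suc \<circ> \<rho>) = under_binder (\<theta> \<circ> \<rho>)"
    by (auto simp: under_binder_def fun_eq_iff split: nat.split)
  then show ?case by (simp only: ren.simps subst.simps Lam)
qed auto

lemma ren_ren: "ren \<rho> (ren \<rho>' t) = ren (\<rho> \<circ> \<rho>') t"
  by (simp only: ren_as_subst[of \<rho>] ren_as_subst[of "\<rho> \<circ> \<rho>'"] subst_ren comp_assoc)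

lemma ren_subst: "ren \<rho> (subst \<theta> t) = subst (ren \<rho> \<circ> \<theta>) t"
proof (induction t arbitrary: \<theta> \<rho>)
  case (Lam \<sigma> t)
  have "ren (case_nat 0 (Suc \<circ> \<rho>)) \<circ> under_binder \<theta> = under_binder (ren \<rho> \<circ> \<theta>)"
    by (auto simp: under_binder_def fun_eq_iff ren_ren comp_def split: nat.split)
  then show ?case by (simp only: ren.simps subst.simps Lam)
qed auto

lemma subst_Var_eq [simp]: "subst Var t = t"
proof (induction t)
  case (Lam \<sigma> t)
  have "under_binder Var = Var"
    by (auto simp: under_binder_def fun_eq_iff split: nat.split)
  with Lam show ?case by simp
qed auto

lemma under_binder_simps [simp]:
  "under_binder \<theta> 0 = Var 0"
  "under_binder \<theta> (Suc i) = lift (\<theta> i)"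
  "under_binder \<theta> (numeral k) = lift (\<theta> (pred_numeral k))"
  by (simp_all add: under_binder_def numeral_eq_Suc)

lemma subst_shift_eq_lift [simp]: "subst (\<lambda>i. Var (Suc i)) t = lift t"
  by (simp add: ren_as_subst comp_def)

lemma subst_under_binder_lift [simp]: "subst (under_binder \<theta>) (lift t) = lift (subst \<theta> t)"
  by (simp add: subst_ren ren_subst under_binder_def comp_def)

text \<open>For \<open>\<theta> = Var\<close>, instantiating a lifted term gives the term back.
  Parameters of an induction can therefore enter open terms as lifted terms and come out
  unchanged.\<close>

lemma subst_case_nat_lift [simp]: "subst (case_nat u \<theta>) (lift t) = subst \<theta> t"
  by (simp add: subst_ren comp_def)

lemma ren_zero [simp]: "ren \<rho> (zero \<tau>) = zero \<tau>"
  by (induction \<tau> arbitrary: \<rho>) auto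

lemma subst_zero [simp]: "subst \<theta> (zero \<tau>) = zero \<tau>"
  by (induction \<tau> arbitrary: \<theta>) auto

section \<open>Type inference as a computation\<close>

fun app_ty :: "ty option \<Rightarrow> ty option \<Rightarrow> ty option" where
  "app_ty (Some (\<sigma> \<rightarrow> \<tau>)) (Some \<sigma>') = (if \<sigma>' = \<sigma> then Some \<tau> else None)"
| "app_ty _ _ = None"

lemma app_ty_eq_Some:
  "app_ty a b = Some \<tau> \<longleftrightarrow> (\<exists>\<sigma>. a = Some (\<sigma> \<rightarrow> \<tau>) \<and> b = Some \<sigma>)"
  by (cases "(a, b)" rule: app_ty.cases) auto

primrec typeof :: "ty list \<Rightarrow> tm \<Rightarrow> ty option" where
  "typeof \<Gamma> (Var i) = (if i < length \<Gamma> then Some (\<Gamma> ! i) else None)"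
| "typeof \<Gamma> (Con c) = Some (const_type c)"
| "typeof \<Gamma> (s \<cdot> t) = app_ty (typeof \<Gamma> s) (typeof \<Gamma> t)"
| "typeof \<Gamma> (Lam \<sigma> t) = map_option (\<lambda>\<tau>. \<sigma> \<rightarrow> \<tau>) (typeof (\<sigma> # \<Gamma>) t)"

text \<open>Abstractions carry their domain type, so typing is syntax-directed and types are unique.
  As a simp rule this turns the typing side conditions of the calculus into computations.\<close>

lemma has_type_iff_typeof [simp]: "has_type \<Gamma> t \<tau> \<longleftrightarrow> typeof \<Gamma> t = Some \<tau>"
proof
  show "has_type \<Gamma> t \<tau> \<Longrightarrow> typeof \<Gamma> t = Some \<tau>"
    by (induction rule: has_type.induct) auto
  show "typeof \<Gamma> t = Some \<tau> \<Longrightarrow> has_type \<Gamma> t \<tau>"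
  proof (induction t arbitrary: \<Gamma> \<tau>)
    case (App s t)
    then obtain \<sigma> where "typeof \<Gamma> s = Some (\<sigma> \<rightarrow> \<tau>)" "typeof \<Gamma> t = Some \<sigma>"
      by (auto simp: app_ty_eq_Some)
    with App.IH show ?case by (blast intro: has_type.intros)
  qed (auto intro: has_type.intros split: if_splits)
qed

text \<open>The hypothesis compares inferred types even for indices outside the context. This makes
  \<open>typeof_lift\<close> a rewrite rule without a typing premise.\<close>

lemma typeof_ren:
  assumes "\<And>i. typeof \<Gamma>' (Var (\<rho> i)) = typeof \<Gamma> (Var i)"
  shows "typeof \<Gamma>' (ren \<rho> t) = typeof \<Gamma> t"
  using assms
proof (induction t arbitrary: \<Gamma> \<Gamma>' \<rho>)
  case (Lam \<sigma> t)
  have "typeof (\<sigma> # \<Gamma>') (Var (case_nat 0 (Suc \<circ> \<rho>) i)) = typeof (\<sigma> # \<Gamma>) (Var i)" for i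
    using Lam.prems[of "i - 1"] by (cases i) (auto split: if_splits)
  from Lam.IH[OF this] show ?case by simp
qed auto

lemma typeof_lift [simp]: "typeof (\<sigma> # \<Gamma>) (lift t) = typeof \<Gamma> t"
  by (rule typeof_ren) simp

text \<open>Only one direction can hold: a substitution may replace an index outside the context by
  a typed term.\<close>

lemma typeof_subst:
  assumes "\<And>i \<sigma>. typeof \<Gamma> (Var i) = Some \<sigma> \<Longrightarrow> typeof \<Gamma>' (\<theta> i) = Some \<sigma>"
    and "typeof \<Gamma> t = Some \<tau>"
  shows "typeof \<Gamma>' (subst \<theta> t) = Some \<tau>"
  using assms
proof (induction t arbitrary: \<Gamma> \<Gamma>' \<theta> \<tau>)
  case (Lam \<sigma> t)
  then obtain \<tau>' where \<tau>': "typeof (\<sigma> # \<Gamma>) t = Some \<tau>'" "\<tau> = (\<sigma> \<rightarrow> \<tau>')" by auto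
  have "typeof (\<sigma> # \<Gamma>') (under_binder \<theta> i) = Some \<rho>" if "typeof (\<sigma> # \<Gamma>) (Var i) = Some \<rho>" for i \<rho>
    using that Lam.prems(1) by (cases i) (auto split: if_splits)
  from Lam.IH[OF this \<tau>'(1)] \<tau>'(2) show ?case by simp
next
  case (App s t)
  then obtain \<sigma> where "typeof \<Gamma> s = Some (\<sigma> \<rightarrow> \<tau>)" "typeof \<Gamma> t = Some \<sigma>"
    by (auto simp: app_ty_eq_Some)
  with App.IH[OF App.prems(1)] show ?case by simp
qed auto

lemma typeof_inst:
  assumes "typeof (\<sigma> # \<Gamma>) t = Some \<tau>" "typeof \<Gamma> u = Some \<sigma>"
  shows "typeof \<Gamma> (inst u t) = Some \<tau>"
  by (rule typeof_subst[OF _ assms(1)]) (use assms in \<open>auto split: nat.split if_splits\<close>)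

lemma typeof_zero [simp]: "typeof \<Gamma> (zero \<tau>) = Some \<tau>"
  using has_type_zero by simp


section \<open>Open terms modulo provable equality\<close>

text \<open>
  For fixed axioms and contexts, terms are identified when they are provably equal of some type,
  and application descends to the classes (ill-typed terms form the empty class). Deductions of
  equations then become rewriting of classes with Isabelle's own equality. Induction,
  extensionality and case distinction move to other contexts, so all facts are kept generic
  in them.
\<close>

definition provably_equal :: "fm set \<Rightarrow> ty list \<Rightarrow> fm list \<Rightarrow> tm \<Rightarrow> tm \<Rightarrow> bool" where
  "provably_equal T \<Gamma> \<Delta> s t \<longleftrightarrow>
     (\<exists>\<tau>. typeof \<Gamma> s = Some \<tau> \<and> typeof \<Gamma> t = Some \<tau> \<and> HA T \<Gamma> \<Delta> (Eq \<tau> s t))"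

definition cl :: "fm set \<Rightarrow> ty list \<Rightarrow> fm list \<Rightarrow> tm \<Rightarrow> tm set" where
  "cl T \<Gamma> \<Delta> s = {t. provably_equal T \<Gamma> \<Delta> s t}"

definition rep :: "fm set \<Rightarrow> ty list \<Rightarrow> fm list \<Rightarrow> tm set \<Rightarrow> tm" where
  "rep T \<Gamma> \<Delta> c = (SOME s. s \<in> c)"

text \<open>A set that is not the class of one of its members, such as the empty set, gets no type.
  A premise \<open>tyc T \<Gamma> \<Delta> c = Some \<tau>\<close> thus says that \<open>c\<close>
  is a class of typed terms, and rules can range over classes instead of terms.\<close>

definition tyc :: "fm set \<Rightarrow> ty list \<Rightarrow> fm list \<Rightarrow> tm set \<Rightarrow> ty option" where
  "tyc T \<Gamma> \<Delta> c = (if \<exists>s\<in>c. c = cl T \<Gamma> \<Delta> s then typeof \<Gamma> (rep T \<Gamma> \<Delta> c) else None)"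

definition ap :: "fm set \<Rightarrow> ty list \<Rightarrow> fm list \<Rightarrow> tm set \<Rightarrow> tm set \<Rightarrow> tm set" where
  "ap T \<Gamma> \<Delta> c d = (if app_ty (tyc T \<Gamma> \<Delta> c) (tyc T \<Gamma> \<Delta> d) = None then {}
     else cl T \<Gamma> \<Delta> (rep T \<Gamma> \<Delta> c \<cdot> rep T \<Gamma> \<Delta> d))"

section \<open>Provable equality as a congruence\<close>

lemma HA_sym:
  assumes "typeof \<Gamma> s = Some \<tau>" "typeof \<Gamma> t = Some \<tau>" "HA T \<Gamma> \<Delta> (Eq \<tau> s t)"
  shows "HA T \<Gamma> \<Delta> (Eq \<tau> t s)"
  using HA.repl[where \<phi> = "Eq \<tau> (Var 0) (lift s)" and \<Gamma> = \<Gamma> and \<tau> = \<tau> and s = s and t = t] assms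
  by (simp add: HA.refl)

lemma HA_trans:
  assumes "typeof \<Gamma> s = Some \<tau>" "typeof \<Gamma> t = Some \<tau>"
    and "HA T \<Gamma> \<Delta> (Eq \<tau> s t)" "HA T \<Gamma> \<Delta> (Eq \<tau> t u)"
  shows "HA T \<Gamma> \<Delta> (Eq \<tau> s u)"
  using HA.repl[where \<phi> = "Eq \<tau> (lift s) (Var 0)" and \<Gamma> = \<Gamma> and \<tau> = \<tau> and s = t and t = u] assms
  by simp

text \<open>The rule \<open>repl\<close> replaces at the place marked by \<open>Var 0\<close>: first
  the argument behind \<open>f\<close>, then the function in front of \<open>t\<close>.\<close>

lemma HA_cong:
  assumes "typeof \<Gamma> f = Some (\<sigma> \<rightarrow> \<tau>)" "typeof \<Gamma> g = Some (\<sigma> \<rightarrow> \<tau>)"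
    and "typeof \<Gamma> s = Some \<sigma>" "typeof \<Gamma> t = Some \<sigma>"
    and "HA T \<Gamma> \<Delta> (Eq (\<sigma> \<rightarrow> \<tau>) f g)" "HA T \<Gamma> \<Delta> (Eq \<sigma> s t)"
  shows "HA T \<Gamma> \<Delta> (Eq \<tau> (f \<cdot> s) (g \<cdot> t))"
proof -
  have 1: "HA T \<Gamma> \<Delta> (Eq \<tau> (f \<cdot> s) (f \<cdot> t))"
    using HA.repl[where \<phi> = "Eq \<tau> (lift f \<cdot> lift s) (lift f \<cdot> Var 0)" and \<Gamma> = \<Gamma> and \<tau> = \<sigma>
        and s = s and t = t] assms
    by (simp add: HA.refl)
  show ?thesis
    using HA.repl[where \<phi> = "Eq \<tau> (lift f \<cdot> lift s) (Var 0 \<cdot> lift t)" and \<Gamma> = \<Gamma> and \<tau> = "\<sigma> \<rightarrow> \<tau>"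
        and s = f and t = g] assms 1
    by simp
qed

lemma provably_equal_refl: "typeof \<Gamma> s \<noteq> None \<Longrightarrow> provably_equal T \<Gamma> \<Delta> s s"
  by (auto simp: provably_equal_def HA.refl)

lemma provably_equal_sym: "provably_equal T \<Gamma> \<Delta> s t \<Longrightarrow> provably_equal T \<Gamma> \<Delta> t s"
  by (auto simp: provably_equal_def intro: HA_sym)

lemma provably_equal_trans:
  "provably_equal T \<Gamma> \<Delta> s t \<Longrightarrow> provably_equal T \<Gamma> \<Delta> t u \<Longrightarrow> provably_equal T \<Gamma> \<Delta> s u"
  unfolding provably_equal_def by (metis HA_trans option.inject)

lemma cl_eqI: "provably_equal T \<Gamma> \<Delta> s t \<Longrightarrow> cl T \<Gamma> \<Delta> s = cl T \<Gamma> \<Delta> t"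
  by (auto simp: cl_def intro: provably_equal_sym provably_equal_trans)

text \<open>The way back from classes to derivations. The type of \<open>t\<close> excludes that
  both classes are empty, when their equality would say nothing.\<close>

lemma HA_Eq_if_cl_eq:
  "cl T \<Gamma> \<Delta> s = cl T \<Gamma> \<Delta> t \<Longrightarrow> typeof \<Gamma> t = Some \<tau> \<Longrightarrow> HA T \<Gamma> \<Delta> (Eq \<tau> s t)"
  using provably_equal_refl[of \<Gamma> t T \<Delta>] unfolding cl_def provably_equal_def set_eq_iff mem_Collect_eq
  by (metis option.distinct(1) option.inject)

lemma cl_eq_if_HA_Eq:
  "HA T \<Gamma> \<Delta> (Eq \<tau> s t) \<Longrightarrow> typeof \<Gamma> s = Some \<tau> \<Longrightarrow> typeof \<Gamma> t = Some \<tau>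
    \<Longrightarrow> cl T \<Gamma> \<Delta> s = cl T \<Gamma> \<Delta> t"
  by (rule cl_eqI) (simp add: provably_equal_def)

lemma cl_untyped: "typeof \<Gamma> s = None \<Longrightarrow> cl T \<Gamma> \<Delta> s = {}"
  by (auto simp: cl_def provably_equal_def)

lemma rep_cl:
  assumes "typeof \<Gamma> s = Some \<tau>"
  shows "provably_equal T \<Gamma> \<Delta> s (rep T \<Gamma> \<Delta> (cl T \<Gamma> \<Delta> s))"
proof -
  have "s \<in> cl T \<Gamma> \<Delta> s" using assms by (simp add: cl_def provably_equal_refl)
  then have "rep T \<Gamma> \<Delta> (cl T \<Gamma> \<Delta> s) \<in> cl T \<Gamma> \<Delta> s"
    unfolding rep_def by (rule someI)
  then show ?thesis by (simp add: cl_def)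
qed

lemma tyc_cl [simp]: "tyc T \<Gamma> \<Delta> (cl T \<Gamma> \<Delta> s) = typeof \<Gamma> s"
proof (cases "typeof \<Gamma> s")
  case (Some \<tau>)
  then have "s \<in> cl T \<Gamma> \<Delta> s" by (simp add: cl_def provably_equal_refl)
  then have "tyc T \<Gamma> \<Delta> (cl T \<Gamma> \<Delta> s) = typeof \<Gamma> (rep T \<Gamma> \<Delta> (cl T \<Gamma> \<Delta> s))"
    unfolding tyc_def by auto
  with rep_cl[OF Some, of T \<Delta>] show ?thesis by (auto simp: provably_equal_def)
qed (simp add: cl_untyped tyc_def)

lemma cl_rep [simp]: "tyc T \<Gamma> \<Delta> c = Some \<tau> \<Longrightarrow> cl T \<Gamma> \<Delta> (rep T \<Gamma> \<Delta> c) = c"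
  and typeof_rep [simp]: "tyc T \<Gamma> \<Delta> c = Some \<tau> \<Longrightarrow> typeof \<Gamma> (rep T \<Gamma> \<Delta> c) = Some \<tau>"
proof -
  assume a: "tyc T \<Gamma> \<Delta> c = Some \<tau>"
  then show "typeof \<Gamma> (rep T \<Gamma> \<Delta> c) = Some \<tau>" by (simp add: tyc_def split: if_splits)
  from a obtain s where s: "s \<in> c" "c = cl T \<Gamma> \<Delta> s" by (auto simp: tyc_def split: if_splits)
  then have "typeof \<Gamma> s = Some \<tau>" using a by simp
  from cl_eqI[OF rep_cl[OF this]] s(2) show "cl T \<Gamma> \<Delta> (rep T \<Gamma> \<Delta> c) = c" by simp
qed

text \<open>\<open>ap\<close> works with chosen representatives; by \<open>HA_cong\<close> the
  choice does not matter. As a simp rule this pushes classes down to constants, variables and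
  abstractions.\<close>

lemma cl_app [simp]: "cl T \<Gamma> \<Delta> (f \<cdot> s) = ap T \<Gamma> \<Delta> (cl T \<Gamma> \<Delta> f) (cl T \<Gamma> \<Delta> s)"
proof (cases "app_ty (typeof \<Gamma> f) (typeof \<Gamma> s)")
  case (Some \<tau>)
  then obtain \<sigma> where ty: "typeof \<Gamma> f = Some (\<sigma> \<rightarrow> \<tau>)" "typeof \<Gamma> s = Some \<sigma>"
    by (auto simp: app_ty_eq_Some)
  have "provably_equal T \<Gamma> \<Delta> (f \<cdot> s)
      (rep T \<Gamma> \<Delta> (cl T \<Gamma> \<Delta> f) \<cdot> rep T \<Gamma> \<Delta> (cl T \<Gamma> \<Delta> s))"
    using rep_cl[OF ty(1), of T \<Delta>] rep_cl[OF ty(2), of T \<Delta>] ty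
    by (simp add: provably_equal_def HA_cong)
  with Some show ?thesis by (simp add: ap_def cl_eqI)
qed (simp add: ap_def cl_untyped)

lemma tyc_ap [simp]:
  "tyc T \<Gamma> \<Delta> (ap T \<Gamma> \<Delta> c d) = app_ty (tyc T \<Gamma> \<Delta> c) (tyc T \<Gamma> \<Delta> d)"
proof (cases "app_ty (tyc T \<Gamma> \<Delta> c) (tyc T \<Gamma> \<Delta> d)")
  case None
  then show ?thesis by (simp add: ap_def) (simp add: tyc_def)
next
  case (Some \<tau>)
  then obtain \<sigma> where "tyc T \<Gamma> \<Delta> c = Some (\<sigma> \<rightarrow> \<tau>)" "tyc T \<Gamma> \<Delta> d = Some \<sigma>"
    by (auto simp: app_ty_eq_Some)
  then show ?thesis by (simp add: ap_def del: cl_app)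
qed

locale term_model =
  fixes T :: "fm set" and \<Gamma> :: "ty list" and \<Delta> :: "fm list"
begin

abbreviation term_class ("\<lbrakk>_\<rbrakk>") where "\<lbrakk>s\<rbrakk> \<equiv> cl T \<Gamma> \<Delta> s"
abbreviation class_app (infixl "\<bullet>" 100) where "c \<bullet> d \<equiv> ap T \<Gamma> \<Delta> c d"
abbreviation cty where "cty c \<equiv> tyc T \<Gamma> \<Delta> c"
abbreviation crep where "crep c \<equiv> rep T \<Gamma> \<Delta> c"

end

text \<open>Makes simplification rules proved in the locale available for all contexts at once.\<close>

interpretation term_model T \<Gamma> \<Delta> for T \<Gamma> \<Delta> .

section \<open>Computation rules as equations between classes\<close>

lemma (in term_model) cl_beta_inst:
  assumes "typeof \<Gamma> u = Some \<sigma>" "typeof (\<sigma> # \<Gamma>) t \<noteq> None"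
  shows "\<lbrakk>Lam \<sigma> t \<cdot> u\<rbrakk> = \<lbrakk>inst u t\<rbrakk>"
proof -
  obtain \<tau> where \<tau>: "typeof (\<sigma> # \<Gamma>) t = Some \<tau>" using assms by auto
  show ?thesis
    by (rule cl_eq_if_HA_Eq[where \<tau> = \<tau>]) (use assms \<tau> in \<open>auto intro!: HA.beta typeof_inst\<close>)
qed

text \<open>Substitution acts on terms, so a class argument is represented by a term. Where this
  term ends up outside all abstractions, \<open>cl_rep\<close> restores the class; below a remaining
  abstraction it stays, and \<open>cl_beta_inst\<close> is the sharper rule.\<close>

lemma (in term_model) cl_beta [simp]:
  assumes "cty c = Some \<sigma>" "typeof (\<sigma> # \<Gamma>) t \<noteq> None"
  shows "\<lbrakk>Lam \<sigma> t\<rbrakk> \<bullet> c = \<lbrakk>inst (crep c) t\<rbrakk>"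
  using cl_beta_inst[of "crep c" \<sigma> t] assms by simp

lemma (in term_model) cl_rec [simp]:
  assumes "cty a = Some \<tau>" "cty f = Some (NatT \<rightarrow> \<tau> \<rightarrow> \<tau>)"
  shows "\<lbrakk>Con (RecC \<tau>)\<rbrakk> \<bullet> a \<bullet> f \<bullet> \<lbrakk>Con ZeroC\<rbrakk> = a"
    and "cty n = Some NatT \<Longrightarrow> \<lbrakk>Con (RecC \<tau>)\<rbrakk> \<bullet> a \<bullet> f \<bullet> (\<lbrakk>Con SuccC\<rbrakk> \<bullet> n)
           = f \<bullet> n \<bullet> (\<lbrakk>Con (RecC \<tau>)\<rbrakk> \<bullet> a \<bullet> f \<bullet> n)"
proof -
  show "\<lbrakk>Con (RecC \<tau>)\<rbrakk> \<bullet> a \<bullet> f \<bullet> \<lbrakk>Con ZeroC\<rbrakk> = a"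
    using cl_eq_if_HA_Eq[OF HA.rec_zero[of \<Gamma> "crep a" \<tau> "crep f" T \<Delta>]] assms by simp
  show "cty n = Some NatT \<Longrightarrow> \<lbrakk>Con (RecC \<tau>)\<rbrakk> \<bullet> a \<bullet> f \<bullet> (\<lbrakk>Con SuccC\<rbrakk> \<bullet> n)
           = f \<bullet> n \<bullet> (\<lbrakk>Con (RecC \<tau>)\<rbrakk> \<bullet> a \<bullet> f \<bullet> n)"
    using cl_eq_if_HA_Eq[OF HA.rec_succ[of \<Gamma> "crep a" \<tau> "crep f" "crep n" T \<Delta>]] assms
    by simp
qed

lemma (in term_model) cl_if [simp]:
  assumes "cty a = Some \<tau>" "cty b = Some \<tau>"
  shows "\<lbrakk>Con (IfC \<tau>)\<rbrakk> \<bullet> \<lbrakk>Con TrueC\<rbrakk> \<bullet> a \<bullet> b = a" "\<lbrakk>Con (IfC \<tau>)\<rbrakk> \<bullet> \<lbrakk>Con FalseC\<rbrakk> \<bullet> a \<bullet> b = b"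
  using cl_eq_if_HA_Eq[OF HA.if_true[of \<Gamma> "crep a" \<tau> "crep b" T \<Delta>]]
    cl_eq_if_HA_Eq[OF HA.if_false[of \<Gamma> "crep a" \<tau> "crep b" T \<Delta>]] assms by simp_all

lemma (in term_model) cl_fst_snd_pair [simp]:
  assumes "cty a = Some \<sigma>" "cty b = Some \<tau>"
  shows "\<lbrakk>Con (FstC \<sigma> \<tau>)\<rbrakk> \<bullet> (\<lbrakk>Con (PairC \<sigma> \<tau>)\<rbrakk> \<bullet> a \<bullet> b) = a"
    and "\<lbrakk>Con (SndC \<sigma> \<tau>)\<rbrakk> \<bullet> (\<lbrakk>Con (PairC \<sigma> \<tau>)\<rbrakk> \<bullet> a \<bullet> b) = b"
  using cl_eq_if_HA_Eq[OF HA.fst_pair[of \<Gamma> "crep a" \<sigma> "crep b" \<tau> T \<Delta>]]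
    cl_eq_if_HA_Eq[OF HA.snd_pair[of \<Gamma> "crep a" \<sigma> "crep b" \<tau> T \<Delta>]] assms by simp_all

section \<open>Assumptions, extensionality, induction and case distinction\<close>

lemma (in term_model) cl_asm:
  assumes "Eq \<tau> s t \<in> set \<Delta>" "typeof \<Gamma> s = Some \<tau>" "typeof \<Gamma> t = Some \<tau>"
  shows "\<lbrakk>s\<rbrakk> = \<lbrakk>t\<rbrakk>"
  by (rule cl_eq_if_HA_Eq[where \<tau> = \<tau>]) (use assms in \<open>auto intro: HA.asm\<close>)

text \<open>The premise speaks of every assumption list containing the lifted assumptions, so nested
  arguments only have to track membership.\<close>

lemma (in term_model) cl_ext:
  assumes "typeof \<Gamma> f = Some (\<sigma> \<rightarrow> \<tau>)" "typeof \<Gamma> g = Some (\<sigma> \<rightarrow> \<tau>)"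
    and "\<And>\<Delta>'. flift ` set \<Delta> \<subseteq> set \<Delta>'
      \<Longrightarrow> cl T (\<sigma> # \<Gamma>) \<Delta>' (lift f \<cdot> Var 0) = cl T (\<sigma> # \<Gamma>) \<Delta>' (lift g \<cdot> Var 0)"
  shows "\<lbrakk>f\<rbrakk> = \<lbrakk>g\<rbrakk>"
  by (rule cl_eq_if_HA_Eq[where \<tau> = "\<sigma> \<rightarrow> \<tau>"])
    (use assms in \<open>simp_all del: cl_app add: HA.ext HA.allI HA_Eq_if_cl_eq\<close>)

text \<open>The induction hypothesis is delivered twice. The class equation serves rewriting on the
  spot; the formula in \<open>\<Delta>'\<close> survives further changes of context, to which class
  equations do not transfer. Since the lemma proves equations only, an implication has to be encoded
  as one.\<close>

lemma (in term_model) cl_nat_induct: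
  defines "\<theta> \<equiv> case_nat (Con SuccC \<cdot> Var 0) (\<lambda>i. Var (Suc i))"
  assumes s: "typeof (NatT # \<Gamma>) s = Some \<tau>" and t: "typeof (NatT # \<Gamma>) t = Some \<tau>"
    and u: "typeof \<Gamma> u = Some NatT"
    and base: "\<lbrakk>inst (Con ZeroC) s\<rbrakk> = \<lbrakk>inst (Con ZeroC) t\<rbrakk>"
    and step: "\<And>\<Delta>'. Eq \<tau> s t \<in> set \<Delta>' \<Longrightarrow> flift ` set \<Delta> \<subseteq> set \<Delta>'
      \<Longrightarrow> cl T (NatT # \<Gamma>) \<Delta>' s = cl T (NatT # \<Gamma>) \<Delta>' t
      \<Longrightarrow> cl T (NatT # \<Gamma>) \<Delta>' (subst \<theta> s) = cl T (NatT # \<Gamma>) \<Delta>' (subst \<theta> t)"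
  shows "\<lbrakk>inst u s\<rbrakk> = \<lbrakk>inst u t\<rbrakk>"
proof -
  define \<Delta>' where "\<Delta>' = Eq \<tau> s t # map flift \<Delta>"
  have "typeof (NatT # \<Gamma>) (subst \<theta> t) = Some \<tau>"
    by (rule typeof_subst[OF _ t]) (auto simp: \<theta>_def split: nat.split if_splits)
  moreover have "cl T (NatT # \<Gamma>) \<Delta>' s = cl T (NatT # \<Gamma>) \<Delta>' t"
    by (rule cl_eq_if_HA_Eq[where \<tau> = \<tau>]) (use s t in \<open>auto simp: \<Delta>'_def intro: HA.asm\<close>)
  ultimately have "HA T (NatT # \<Gamma>) \<Delta>' (Eq \<tau> (subst \<theta> s) (subst \<theta> t))"
    by (intro HA_Eq_if_cl_eq step) (auto simp: \<Delta>'_def)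
  moreover have "HA T \<Gamma> \<Delta> (Eq \<tau> (inst (Con ZeroC) s) (inst (Con ZeroC) t))"
    using base t by (intro HA_Eq_if_cl_eq typeof_inst) auto
  ultimately have "HA T \<Gamma> \<Delta> (Forall NatT (Eq \<tau> s t))"
    using s t by - (rule HA.nat_induct, simp_all add: \<Delta>'_def \<theta>_def HA.allI HA.impI)
  from HA.allE[OF this, of u] u have "HA T \<Gamma> \<Delta> (Eq \<tau> (inst u s) (inst u t))" by simp
  then show ?thesis using s t u by (intro cl_eq_if_HA_Eq[where \<tau> = \<tau>]) (auto intro: typeof_inst)
qed

text \<open>The rule \<open>bool_cases\<close> is applied to the implication from
  \<open>b = x\<close> to \<open>s = t\<close> with a fresh boolean \<open>x\<close>, which is then
  instantiated by \<open>b\<close> itself. In each branch the antecedent becomes an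
  assumption.\<close>

lemma (in term_model) cl_bool_cases:
  assumes ty: "typeof \<Gamma> b = Some BoolT" "typeof \<Gamma> s = Some \<tau>" "typeof \<Gamma> t = Some \<tau>"
    and step: "\<And>v \<Delta>'. v = TrueC \<or> v = FalseC \<Longrightarrow> set \<Delta> \<subseteq> set \<Delta>'
      \<Longrightarrow> cl T \<Gamma> \<Delta>' b = cl T \<Gamma> \<Delta>' (Con v) \<Longrightarrow> cl T \<Gamma> \<Delta>' s = cl T \<Gamma> \<Delta>' t"
  shows "\<lbrakk>s\<rbrakk> = \<lbrakk>t\<rbrakk>"
proof -
  let ?\<phi> = "Imp (Eq BoolT (lift b) (Var 0)) (Eq \<tau> (lift s) (lift t))"
  have "HA T \<Gamma> \<Delta> (finst (Con v) ?\<phi>)" if "v = TrueC \<or> v = FalseC" for v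
  proof -
    let ?\<Delta> = "Eq BoolT b (Con v) # \<Delta>"
    have v: "const_type v = BoolT" using that by auto
    have "cl T \<Gamma> ?\<Delta> b = cl T \<Gamma> ?\<Delta> (Con v)"
      by (rule cl_eq_if_HA_Eq[where \<tau> = BoolT]) (use ty v in \<open>auto intro: HA.asm\<close>)
    then have "cl T \<Gamma> ?\<Delta> s = cl T \<Gamma> ?\<Delta> t"
      by (intro step[OF that]) auto
    with ty v show ?thesis
      by (auto simp del: cl_app intro: HA.impI HA_Eq_if_cl_eq)
  qed
  then have "HA T \<Gamma> \<Delta> (Forall BoolT ?\<phi>)"
    using ty by (intro HA.bool_cases) auto
  from HA.allE[OF this, of b] ty have "HA T \<Gamma> \<Delta> (Imp (Eq BoolT b b) (Eq \<tau> s t))"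
    by simp
  from HA.impE[OF this HA.refl] ty have "HA T \<Gamma> \<Delta> (Eq \<tau> s t)" by simp
  then show ?thesis using ty by (intro cl_eq_if_HA_Eq)
qed


section \<open>Combinators\<close>

lemma subst_closed [simp]:
  "subst \<theta> pred_tm = pred_tm" "subst \<theta> minus_tm = minus_tm" "subst \<theta> less_tm = less_tm"
  "subst \<theta> (prepend X) = prepend X" "subst \<theta> (section_tm X R) = section_tm X R"
  by (simp_all add: pred_tm_def minus_tm_def less_tm_def prepend_def section_tm_def numeral_eq_Suc)

lemma ren_closed [simp]:
  "ren \<rho> pred_tm = pred_tm" "ren \<rho> minus_tm = minus_tm" "ren \<rho> less_tm = less_tm"
  "ren \<rho> (prepend X) = prepend X" "ren \<rho> (section_tm X R) = section_tm X R"
  by (simp_all add: ren_as_subst)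

lemma typeof_closed [simp]:
  "typeof \<Gamma> pred_tm = Some (NatT \<rightarrow> NatT)"
  "typeof \<Gamma> minus_tm = Some (NatT \<rightarrow> NatT \<rightarrow> NatT)"
  "typeof \<Gamma> less_tm = Some (NatT \<rightarrow> NatT \<rightarrow> BoolT)"
  "typeof \<Gamma> (prepend X) = Some (X \<rightarrow> (NatT \<rightarrow> X) \<rightarrow> NatT \<rightarrow> X)"
  "typeof \<Gamma> (section_tm X R) = Some (((NatT \<rightarrow> X) \<rightarrow> R) \<rightarrow> X \<rightarrow> (NatT \<rightarrow> X) \<rightarrow> R)"
  by (simp_all add: pred_tm_def minus_tm_def less_tm_def prepend_def section_tm_def numeral_eq_Suc)

text \<open>Recursion runs over the second summand. As \<open>shift_tm\<close> reads a sequence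
  \<open>a\<close> at \<open>n + k\<close>, its entry at \<open>k = 0\<close> is \<open>a n\<close>
  by computation; a zero or successor as first summand requires induction.\<close>

definition add_tm :: tm where
  "add_tm = Lam NatT (Lam NatT
     (Con (RecC NatT) \<cdot> Var 1 \<cdot> Lam NatT (Lam NatT (Con SuccC \<cdot> Var 0)) \<cdot> Var 0))"

definition shift_tm :: "ty \<Rightarrow> tm" where
  "shift_tm X = Lam (NatT \<rightarrow> X) (Lam NatT (Lam NatT (Var 2 \<cdot> (add_tm \<cdot> Var 1 \<cdot> Var 0))))"

definition tail_tm :: "ty \<Rightarrow> tm" where
  "tail_tm X = Lam (NatT \<rightarrow> X) (Lam NatT (Var 1 \<cdot> (Con SuccC \<cdot> Var 0)))"

text \<open>\<open>\<lambda>\<alpha> q n. q\<^sub>t\<close> for the initial segment \<open>t\<close> of length \<open>n\<close> of \<open>\<alpha>\<close>.\<close>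

definition sections_tm :: "ty \<Rightarrow> ty \<Rightarrow> tm" where
  "sections_tm X R = Lam (NatT \<rightarrow> X) (Lam ((NatT \<rightarrow> X) \<rightarrow> R) (Lam NatT
     (Con (RecC ((NatT \<rightarrow> X) \<rightarrow> R)) \<cdot> Var 1
        \<cdot> Lam NatT (Lam ((NatT \<rightarrow> X) \<rightarrow> R) (section_tm X R \<cdot> Var 0 \<cdot> (Var 4 \<cdot> Var 1))) \<cdot> Var 0)))"

lemma subst_combinators [simp]:
  "subst \<theta> add_tm = add_tm" "subst \<theta> (shift_tm X) = shift_tm X" "subst \<theta> (tail_tm X) = tail_tm X"
  "subst \<theta> (sections_tm X R) = sections_tm X R"
  by (simp_all add: add_tm_def shift_tm_def tail_tm_def sections_tm_def numeral_eq_Suc)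

lemma ren_combinators [simp]:
  "ren \<rho> add_tm = add_tm" "ren \<rho> (shift_tm X) = shift_tm X" "ren \<rho> (tail_tm X) = tail_tm X"
  "ren \<rho> (sections_tm X R) = sections_tm X R"
  by (simp_all add: ren_as_subst)

lemma typeof_combinators [simp]:
  "typeof \<Gamma> add_tm = Some (NatT \<rightarrow> NatT \<rightarrow> NatT)"
  "typeof \<Gamma> (shift_tm X) = Some ((NatT \<rightarrow> X) \<rightarrow> NatT \<rightarrow> NatT \<rightarrow> X)"
  "typeof \<Gamma> (tail_tm X) = Some ((NatT \<rightarrow> X) \<rightarrow> NatT \<rightarrow> X)"
  "typeof \<Gamma> (sections_tm X R) =
     Some ((NatT \<rightarrow> X) \<rightarrow> ((NatT \<rightarrow> X) \<rightarrow> R) \<rightarrow> NatT \<rightarrow> (NatT \<rightarrow> X) \<rightarrow> R)"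
  by (simp_all add: add_tm_def shift_tm_def tail_tm_def sections_tm_def numeral_eq_Suc)

section \<open>Computation rules of the combinators\<close>

lemma (in term_model) cl_pred [simp]:
  "\<lbrakk>pred_tm\<rbrakk> \<bullet> \<lbrakk>Con ZeroC\<rbrakk> = \<lbrakk>Con ZeroC\<rbrakk>"
  "cty n = Some NatT \<Longrightarrow> \<lbrakk>pred_tm\<rbrakk> \<bullet> (\<lbrakk>Con SuccC\<rbrakk> \<bullet> n) = n"
  by (simp_all add: pred_tm_def)

lemma (in term_model) cl_minus [simp]:
  assumes "cty n = Some NatT"
  shows "\<lbrakk>minus_tm\<rbrakk> \<bullet> n \<bullet> \<lbrakk>Con ZeroC\<rbrakk> = n"
    and "cty m = Some NatT
      \<Longrightarrow> \<lbrakk>minus_tm\<rbrakk> \<bullet> n \<bullet> (\<lbrakk>Con SuccC\<rbrakk> \<bullet> m) = \<lbrakk>pred_tm\<rbrakk> \<bullet> (\<lbrakk>minus_tm\<rbrakk> \<bullet> n \<bullet> m)"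
  using assms by (simp_all add: minus_tm_def)

lemma (in term_model) cl_add [simp]:
  assumes "cty n = Some NatT"
  shows "\<lbrakk>add_tm\<rbrakk> \<bullet> n \<bullet> \<lbrakk>Con ZeroC\<rbrakk> = n"
    and "cty m = Some NatT
      \<Longrightarrow> \<lbrakk>add_tm\<rbrakk> \<bullet> n \<bullet> (\<lbrakk>Con SuccC\<rbrakk> \<bullet> m) = \<lbrakk>Con SuccC\<rbrakk> \<bullet> (\<lbrakk>add_tm\<rbrakk> \<bullet> n \<bullet> m)"
  using assms by (simp_all add: add_tm_def)

lemma (in term_model) cl_shift [simp]:
  assumes "cty a = Some (NatT \<rightarrow> X)" "cty n = Some NatT" "cty k = Some NatT"
  shows "\<lbrakk>shift_tm X\<rbrakk> \<bullet> a \<bullet> n \<bullet> k = a \<bullet> (\<lbrakk>add_tm\<rbrakk> \<bullet> n \<bullet> k)"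
  using assms by (simp add: shift_tm_def numeral_eq_Suc)

lemma (in term_model) cl_tail [simp]:
  assumes "cty b = Some (NatT \<rightarrow> X)" "cty m = Some NatT"
  shows "\<lbrakk>tail_tm X\<rbrakk> \<bullet> b \<bullet> m = b \<bullet> (\<lbrakk>Con SuccC\<rbrakk> \<bullet> m)"
  using assms by (simp add: tail_tm_def)

lemma (in term_model) cl_prepend [simp]:
  assumes "cty x = Some X" "cty b = Some (NatT \<rightarrow> X)"
  shows "\<lbrakk>prepend X\<rbrakk> \<bullet> x \<bullet> b \<bullet> \<lbrakk>Con ZeroC\<rbrakk> = x"
    and "cty m = Some NatT \<Longrightarrow> \<lbrakk>prepend X\<rbrakk> \<bullet> x \<bullet> b \<bullet> (\<lbrakk>Con SuccC\<rbrakk> \<bullet> m) = b \<bullet> m"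
  using assms by (simp_all add: prepend_def numeral_eq_Suc)

lemma (in term_model) cl_section [simp]:
  assumes "cty q = Some ((NatT \<rightarrow> X) \<rightarrow> R)" "cty x = Some X" "cty b = Some (NatT \<rightarrow> X)"
  shows "\<lbrakk>section_tm X R\<rbrakk> \<bullet> q \<bullet> x \<bullet> b = q \<bullet> (\<lbrakk>prepend X\<rbrakk> \<bullet> x \<bullet> b)"
  using assms by (simp add: section_tm_def numeral_eq_Suc)

lemma (in term_model) cl_sections [simp]:
  assumes "cty q = Some ((NatT \<rightarrow> X) \<rightarrow> R)" "cty a = Some (NatT \<rightarrow> X)"
  shows "\<lbrakk>sections_tm X R\<rbrakk> \<bullet> a \<bullet> q \<bullet> \<lbrakk>Con ZeroC\<rbrakk> = q"
    and "cty n = Some NatT \<Longrightarrow> \<lbrakk>sections_tm X R\<rbrakk> \<bullet> a \<bullet> q \<bullet> (\<lbrakk>Con SuccC\<rbrakk> \<bullet> n)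
      = \<lbrakk>section_tm X R\<rbrakk> \<bullet> (\<lbrakk>sections_tm X R\<rbrakk> \<bullet> a \<bullet> q \<bullet> n) \<bullet> (a \<bullet> n)"
  using assms by (simp_all add: sections_tm_def numeral_eq_Suc)

section \<open>Addition, subtraction and the strict order\<close>

lemma (in term_model) cl_less:
  assumes "cty m = Some NatT" "cty n = Some NatT"
  shows "\<lbrakk>less_tm\<rbrakk> \<bullet> m \<bullet> n = \<lbrakk>Con (RecC BoolT)\<rbrakk> \<bullet> \<lbrakk>Con FalseC\<rbrakk>
    \<bullet> \<lbrakk>Lam NatT (Lam BoolT (Con TrueC))\<rbrakk> \<bullet> (\<lbrakk>minus_tm\<rbrakk> \<bullet> n \<bullet> m)"
  using assms by (simp add: less_tm_def numeral_eq_Suc)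

text \<open>The pattern of the inductions below: both sides are written as instances, at a
  representative of \<open>n\<close>, of open terms in \<open>Var 0\<close>, to which
  \<open>cl_nat_induct\<close> applies. Other classes enter as lifted representatives.\<close>

lemma (in term_model) cl_zero_add [simp]:
  assumes "cty n = Some NatT"
  shows "\<lbrakk>add_tm\<rbrakk> \<bullet> \<lbrakk>Con ZeroC\<rbrakk> \<bullet> n = n"
proof -
  have "\<lbrakk>inst (crep n) (add_tm \<cdot> Con ZeroC \<cdot> Var 0)\<rbrakk> = \<lbrakk>inst (crep n) (Var 0)\<rbrakk>"
    by (rule cl_nat_induct[where \<tau> = NatT]) (use assms in simp_all)
  then show ?thesis using assms by simp
qed

lemma (in term_model) cl_Suc_add [simp]:
  assumes "cty m = Some NatT" "cty n = Some NatT"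
  shows "\<lbrakk>add_tm\<rbrakk> \<bullet> (\<lbrakk>Con SuccC\<rbrakk> \<bullet> m) \<bullet> n = \<lbrakk>Con SuccC\<rbrakk> \<bullet> (\<lbrakk>add_tm\<rbrakk> \<bullet> m \<bullet> n)"
proof -
  have "\<lbrakk>inst (crep n) (add_tm \<cdot> (Con SuccC \<cdot> lift (crep m)) \<cdot> Var 0)\<rbrakk> =
      \<lbrakk>inst (crep n) (Con SuccC \<cdot> (add_tm \<cdot> lift (crep m) \<cdot> Var 0))\<rbrakk>"
    by (rule cl_nat_induct[where \<tau> = NatT]) (use assms in simp_all)
  then show ?thesis using assms by simp
qed

lemma (in term_model) cl_zero_minus:
  assumes "cty n = Some NatT"
  shows "\<lbrakk>minus_tm\<rbrakk> \<bullet> \<lbrakk>Con ZeroC\<rbrakk> \<bullet> n = \<lbrakk>Con ZeroC\<rbrakk>"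
proof -
  have "\<lbrakk>inst (crep n) (minus_tm \<cdot> Con ZeroC \<cdot> Var 0)\<rbrakk> = \<lbrakk>inst (crep n) (Con ZeroC)\<rbrakk>"
    by (rule cl_nat_induct[where \<tau> = NatT]) (use assms in simp_all)
  then show ?thesis using assms by simp
qed

text \<open>Subtraction recurses on the subtrahend, so the left side is what the difference of the
  two successors computes to. Hence the order is invariant under successor.\<close>

lemma (in term_model) cl_Suc_minus_Suc:
  assumes "cty m = Some NatT" "cty n = Some NatT"
  shows "\<lbrakk>pred_tm\<rbrakk> \<bullet> (\<lbrakk>minus_tm\<rbrakk> \<bullet> (\<lbrakk>Con SuccC\<rbrakk> \<bullet> m) \<bullet> n) = \<lbrakk>minus_tm\<rbrakk> \<bullet> m \<bullet> n"
proof -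
  have "\<lbrakk>inst (crep n) (pred_tm \<cdot> (minus_tm \<cdot> (Con SuccC \<cdot> lift (crep m)) \<cdot> Var 0))\<rbrakk> =
      \<lbrakk>inst (crep n) (minus_tm \<cdot> lift (crep m) \<cdot> Var 0)\<rbrakk>"
    by (rule cl_nat_induct[where \<tau> = NatT]) (use assms in simp_all)
  then show ?thesis using assms by simp
qed

lemma (in term_model) cl_less_zero_right [simp]:
  "cty m = Some NatT \<Longrightarrow> \<lbrakk>less_tm\<rbrakk> \<bullet> m \<bullet> \<lbrakk>Con ZeroC\<rbrakk> = \<lbrakk>Con FalseC\<rbrakk>"
  by (simp add: cl_less cl_zero_minus)

lemma (in term_model) cl_less_zero_Suc [simp]:
  "cty n = Some NatT \<Longrightarrow> \<lbrakk>less_tm\<rbrakk> \<bullet> \<lbrakk>Con ZeroC\<rbrakk> \<bullet> (\<lbrakk>Con SuccC\<rbrakk> \<bullet> n) = \<lbrakk>Con TrueC\<rbrakk>"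
  by (simp add: cl_less)

lemma (in term_model) cl_less_Suc_Suc [simp]:
  "cty m = Some NatT \<Longrightarrow> cty n = Some NatT
    \<Longrightarrow> \<lbrakk>less_tm\<rbrakk> \<bullet> (\<lbrakk>Con SuccC\<rbrakk> \<bullet> m) \<bullet> (\<lbrakk>Con SuccC\<rbrakk> \<bullet> n) = \<lbrakk>less_tm\<rbrakk> \<bullet> m \<bullet> n"
  by (simp add: cl_less cl_Suc_minus_Suc)

section \<open>Shifting, prepending and tails\<close>

lemma (in term_model) cl_shift_zero:
  assumes "cty a = Some (NatT \<rightarrow> X)"
  shows "\<lbrakk>shift_tm X\<rbrakk> \<bullet> a \<bullet> \<lbrakk>Con ZeroC\<rbrakk> = a"
proof -
  have "\<lbrakk>shift_tm X \<cdot> crep a \<cdot> Con ZeroC\<rbrakk> = \<lbrakk>crep a\<rbrakk>"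
    by (rule cl_ext[where \<sigma> = NatT and \<tau> = X]) (use assms in simp_all)
  with assms show ?thesis by simp
qed

lemma (in term_model) cl_prepend_shift:
  assumes "cty a = Some (NatT \<rightarrow> X)" "cty n = Some NatT"
  shows "\<lbrakk>prepend X\<rbrakk> \<bullet> (a \<bullet> n) \<bullet> (\<lbrakk>shift_tm X\<rbrakk> \<bullet> a \<bullet> (\<lbrakk>Con SuccC\<rbrakk> \<bullet> n))
    = \<lbrakk>shift_tm X\<rbrakk> \<bullet> a \<bullet> n"
proof -
  let ?f = "prepend X \<cdot> (crep a \<cdot> crep n) \<cdot> (shift_tm X \<cdot> crep a \<cdot> (Con SuccC \<cdot> crep n))"
  let ?g = "shift_tm X \<cdot> crep a \<cdot> crep n"
  have "\<lbrakk>?f\<rbrakk> = \<lbrakk>?g\<rbrakk>"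
  proof (rule cl_ext[where \<sigma> = NatT and \<tau> = X])
    fix \<Delta>'
    \<comment> \<open>The entry at 0 and the later entries are compared separately, by an induction
      on the index. The second lift makes room for the induction variable, which is then
      instantiated by the variable of extensionality.\<close>
    have "cl T (NatT # \<Gamma>) \<Delta>' (inst (Var 0) (lift (lift ?f) \<cdot> Var 0))
        = cl T (NatT # \<Gamma>) \<Delta>' (inst (Var 0) (lift (lift ?g) \<cdot> Var 0))"
      by (rule term_model.cl_nat_induct[where \<tau> = X]) (use assms in simp_all)
    then show "cl T (NatT # \<Gamma>) \<Delta>' (lift ?f \<cdot> Var 0) = cl T (NatT # \<Gamma>) \<Delta>' (lift ?g \<cdot> Var 0)"
      by simp
  qed (use assms in simp_all)
  with assms show ?thesis by simp
qed

lemma (in term_model) cl_tail_shift: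
  assumes "cty a = Some (NatT \<rightarrow> X)" "cty n = Some NatT"
  shows "\<lbrakk>tail_tm X\<rbrakk> \<bullet> (\<lbrakk>shift_tm X\<rbrakk> \<bullet> a \<bullet> n) = \<lbrakk>shift_tm X\<rbrakk> \<bullet> a \<bullet> (\<lbrakk>Con SuccC\<rbrakk> \<bullet> n)"
proof -
  have "\<lbrakk>tail_tm X \<cdot> (shift_tm X \<cdot> crep a \<cdot> crep n)\<rbrakk> = \<lbrakk>shift_tm X \<cdot> crep a \<cdot> (Con SuccC \<cdot> crep n)\<rbrakk>"
    by (rule cl_ext[where \<sigma> = NatT and \<tau> = X]) (use assms in simp_all)
  with assms show ?thesis by simp
qed

text \<open>Together with evaluation at 0, this lets an equation between sequences be split into its
  first entry and the rest.\<close>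

lemma (in term_model) cl_tail_prepend:
  assumes "cty x = Some X" "cty b = Some (NatT \<rightarrow> X)"
  shows "\<lbrakk>tail_tm X\<rbrakk> \<bullet> (\<lbrakk>prepend X\<rbrakk> \<bullet> x \<bullet> b) = b"
proof -
  have "\<lbrakk>tail_tm X \<cdot> (prepend X \<cdot> crep x \<cdot> crep b)\<rbrakk> = \<lbrakk>crep b\<rbrakk>"
    by (rule cl_ext[where \<sigma> = NatT and \<tau> = X]) (use assms in simp_all)
  with assms show ?thesis by simp
qed

lemma (in term_model) cl_tail_zero:
  "\<lbrakk>tail_tm X\<rbrakk> \<bullet> \<lbrakk>zero (NatT \<rightarrow> X)\<rbrakk> = \<lbrakk>zero (NatT \<rightarrow> X)\<rbrakk>"
proof -
  have "\<lbrakk>tail_tm X \<cdot> zero (NatT \<rightarrow> X)\<rbrakk> = \<lbrakk>zero (NatT \<rightarrow> X)\<rbrakk>"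
    by (rule cl_ext[where \<sigma> = NatT and \<tau> = X]) simp_all
  then show ?thesis by simp
qed

section \<open>Irreflexivity and weakening of the order\<close>

lemma (in term_model) cl_less_self:
  assumes "cty n = Some NatT"
  shows "\<lbrakk>less_tm\<rbrakk> \<bullet> n \<bullet> n = \<lbrakk>Con FalseC\<rbrakk>"
proof -
  have "\<lbrakk>inst (crep n) (less_tm \<cdot> Var 0 \<cdot> Var 0)\<rbrakk> = \<lbrakk>inst (crep n) (Con FalseC)\<rbrakk>"
    by (rule cl_nat_induct[where \<tau> = BoolT]) (use assms in simp_all)
  with assms show ?thesis by simp
qed

text \<open>The implication is encoded as a boolean conditional equal to true. Abstracting
  \<open>m\<close> makes the induction on \<open>n\<close> one about functions, so that its
  hypothesis covers all \<open>m\<close>; the step then splits \<open>m\<close> into zero and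
  successor.\<close>

lemma (in term_model) cl_less_SucI:
  assumes "cty m = Some NatT" "cty n = Some NatT" and less: "\<lbrakk>less_tm\<rbrakk> \<bullet> m \<bullet> n = \<lbrakk>Con TrueC\<rbrakk>"
  shows "\<lbrakk>less_tm\<rbrakk> \<bullet> m \<bullet> (\<lbrakk>Con SuccC\<rbrakk> \<bullet> n) = \<lbrakk>Con TrueC\<rbrakk>"
proof -
  let ?imp = "\<lambda>m n. Con (IfC BoolT) \<cdot> (less_tm \<cdot> m \<cdot> n) \<cdot> (less_tm \<cdot> m \<cdot> (Con SuccC \<cdot> n)) \<cdot> Con TrueC"
  let ?s = "Lam NatT (?imp (Var 0) (Var 1))" and ?t = "Lam NatT (Con TrueC)"
  have "\<lbrakk>inst (crep n) ?s\<rbrakk> = \<lbrakk>inst (crep n) ?t\<rbrakk>"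
  proof (rule cl_nat_induct[where \<tau> = "NatT \<rightarrow> BoolT"])
    show "\<lbrakk>inst (Con ZeroC) ?s\<rbrakk> = \<lbrakk>inst (Con ZeroC) ?t\<rbrakk>"
      by (rule cl_ext[where \<sigma> = NatT and \<tau> = BoolT]) (simp_all add: numeral_eq_Suc)
  next
    fix \<Delta>1
    assume IH: "Eq (NatT \<rightarrow> BoolT) ?s ?t \<in> set \<Delta>1"
    let ?\<theta> = "case_nat (Con SuccC \<cdot> Var 0) (\<lambda>i. Var (Suc i))"
    show "cl T (NatT # \<Gamma>) \<Delta>1 (subst ?\<theta> ?s) = cl T (NatT # \<Gamma>) \<Delta>1 (subst ?\<theta> ?t)"
    proof (rule term_model.cl_ext[where \<sigma> = NatT and \<tau> = BoolT])
      fix \<Delta>2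
      assume \<Delta>2: "flift ` set \<Delta>1 \<subseteq> set \<Delta>2"
      have "cl T (NatT # NatT # \<Gamma>) \<Delta>2 (inst (Var 0) (?imp (Var 0) (Con SuccC \<cdot> Var 2)))
          = cl T (NatT # NatT # \<Gamma>) \<Delta>2 (inst (Var 0) (Con TrueC))"
      proof (rule term_model.cl_nat_induct[where \<tau> = BoolT])
        fix \<Delta>3
        assume \<Delta>3: "flift ` set \<Delta>2 \<subseteq> set \<Delta>3"
        \<comment> \<open>Lifted past two new variables, the outer hypothesis is applied to
          \<open>Var 0\<close>, the predecessor of the argument: both comparisons lose a successor
          on each side.\<close>
        have "flift (flift (Eq (NatT \<rightarrow> BoolT) ?s ?t)) \<in> set \<Delta>3"
          using IH \<Delta>2 \<Delta>3 by blast
        then have "cl T (NatT # NatT # NatT # \<Gamma>) \<Delta>3 (Lam NatT (?imp (Var 0) (Var 3)))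
            = cl T (NatT # NatT # NatT # \<Gamma>) \<Delta>3 ?t"
          by (intro term_model.cl_asm[where \<tau> = "NatT \<rightarrow> BoolT"]) (simp_all add: numeral_eq_Suc)
        then have "cl T (NatT # NatT # NatT # \<Gamma>) \<Delta>3 (Lam NatT (?imp (Var 0) (Var 3)) \<cdot> Var 0)
            = cl T (NatT # NatT # NatT # \<Gamma>) \<Delta>3 (?t \<cdot> Var 0)"
          by (simp only: cl_app)
        then show "cl T (NatT # NatT # NatT # \<Gamma>) \<Delta>3 (subst ?\<theta> (?imp (Var 0) (Con SuccC \<cdot> Var 2)))
            = cl T (NatT # NatT # NatT # \<Gamma>) \<Delta>3 (subst ?\<theta> (Con TrueC))"
          by (simp add: numeral_eq_Suc)
      qed (simp_all add: numeral_eq_Suc)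
      then show "cl T (NatT # NatT # \<Gamma>) \<Delta>2 (lift (subst ?\<theta> ?s) \<cdot> Var 0)
          = cl T (NatT # NatT # \<Gamma>) \<Delta>2 (lift (subst ?\<theta> ?t) \<cdot> Var 0)"
        by (simp add: numeral_eq_Suc)
    qed (simp_all add: numeral_eq_Suc)
  qed (use assms in \<open>simp_all add: numeral_eq_Suc\<close>)
  then have "\<lbrakk>inst (crep n) ?s\<rbrakk> \<bullet> m = \<lbrakk>inst (crep n) ?t\<rbrakk> \<bullet> m" by simp
  with assms show ?thesis by simp
qed

text \<open>By induction on \<open>n\<close>: the section at stage \<open>n + 1\<close> prepends
  \<open>a n\<close> to the tail from \<open>n + 1\<close>, which by \<open>cl_prepend_shift\<close>
  gives the tail from \<open>n\<close>.\<close>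

lemma (in term_model) cl_sections_shift:
  assumes "cty q = Some ((NatT \<rightarrow> X) \<rightarrow> R)" "cty a = Some (NatT \<rightarrow> X)" "cty n = Some NatT"
  shows "\<lbrakk>sections_tm X R\<rbrakk> \<bullet> a \<bullet> q \<bullet> n \<bullet> (\<lbrakk>shift_tm X\<rbrakk> \<bullet> a \<bullet> n) = q \<bullet> a"
proof -
  let ?a = "lift (crep a)" and ?q = "lift (crep q)"
  have "\<lbrakk>inst (crep n) (sections_tm X R \<cdot> ?a \<cdot> ?q \<cdot> Var 0 \<cdot> (shift_tm X \<cdot> ?a \<cdot> Var 0))\<rbrakk>
      = \<lbrakk>inst (crep n) (?q \<cdot> ?a)\<rbrakk>"
    by (rule cl_nat_induct[where \<tau> = R]) (use assms in \<open>simp_all add: cl_shift_zero term_model.cl_prepend_shift\<close>)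
  with assms show ?thesis by simp
qed


section \<open>The functional \<open>eps\<close>\<close>

abbreviation eps :: "ty \<Rightarrow> ty \<Rightarrow> tm \<Rightarrow> tm \<Rightarrow> tm \<Rightarrow> tm \<Rightarrow> tm" where
  "eps X R l n e q \<equiv> Con (EpsC X R) \<cdot> l \<cdot> n \<cdot> e \<cdot> q"

text \<open>The argument of \<open>e n\<close> in the defining equation. Spector's \<open>p\<close>
  will be its composition with the first projection.\<close>

definition eps_continuation :: "ty \<Rightarrow> ty \<Rightarrow> tm \<Rightarrow> tm \<Rightarrow> tm \<Rightarrow> tm \<Rightarrow> tm" where
  "eps_continuation X R l n e q = Lam X (section_tm X R \<cdot> lift q \<cdot> Var 0
     \<cdot> eps X R (lift l) (Con SuccC \<cdot> lift n) (lift e) (section_tm X R \<cdot> lift q \<cdot> Var 0))"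

locale eps_model = term_model +
  fixes X R :: ty and l e :: tm
  assumes axioms: "eps_axioms \<subseteq> T"
    and typeof_l [simp]: "typeof \<Gamma> l = Some (R \<rightarrow> NatT)"
    and typeof_e [simp]: "typeof \<Gamma> e = Some (NatT \<rightarrow> J R X)"

lemma (in eps_model) typeof_eps_continuation [simp]:
  assumes "typeof \<Gamma> n = Some NatT" "typeof \<Gamma> q = Some ((NatT \<rightarrow> X) \<rightarrow> R)"
  shows "typeof \<Gamma> (eps_continuation X R l n e q) = Some (X \<rightarrow> R)"
  using assms by (simp add: eps_continuation_def)

lemma (in eps_model) cl_eps:
  assumes "typeof \<Gamma> n = Some NatT" "typeof \<Gamma> q = Some ((NatT \<rightarrow> X) \<rightarrow> R)"
  defines "c \<equiv> e \<cdot> n \<cdot> eps_continuation X R l n e q"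
  shows "\<lbrakk>eps X R l n e q\<rbrakk> =
    \<lbrakk>Con (IfC (NatT \<rightarrow> X)) \<cdot> (less_tm \<cdot> (l \<cdot> (q \<cdot> zero (NatT \<rightarrow> X))) \<cdot> n) \<cdot> zero (NatT \<rightarrow> X)
      \<cdot> (prepend X \<cdot> c \<cdot> eps X R l (Con SuccC \<cdot> n) e (section_tm X R \<cdot> q \<cdot> c))\<rbrakk>"
proof (rule cl_eq_if_HA_Eq[where \<tau> = "NatT \<rightarrow> X"])
  have "HA T \<Gamma> \<Delta> (eps_equation X R)"
    by (rule HA.ax) (use axioms wff_eps_equation in \<open>auto simp: eps_axioms_def\<close>)
  note 1 = this[unfolded eps_equation_def Let_def]
  \<comment> \<open>The quantifiers are opened from the outside in, normalising the index
    substitution each time.\<close>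
  note 2 = HA.allE[OF 1, of e, simplified]
  note 3 = HA.allE[OF 2, of l, simplified]
  note 4 = HA.allE[OF 3, of n, simplified]
  note 5 = HA.allE[OF 4, of q, simplified]
  show "HA T \<Gamma> \<Delta> (Eq (NatT \<rightarrow> X) (eps X R l n e q)
    (Con (IfC (NatT \<rightarrow> X)) \<cdot> (less_tm \<cdot> (l \<cdot> (q \<cdot> zero (NatT \<rightarrow> X))) \<cdot> n) \<cdot> zero (NatT \<rightarrow> X)
      \<cdot> (prepend X \<cdot> c \<cdot> eps X R l (Con SuccC \<cdot> n) e (section_tm X R \<cdot> q \<cdot> c))))"
    using 5 assms by (simp add: eps_continuation_def)
qed (use assms in simp_all)

lemma (in eps_model) cl_eps_stop:
  assumes "typeof \<Gamma> n = Some NatT" "typeof \<Gamma> q = Some ((NatT \<rightarrow> X) \<rightarrow> R)"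
    and "\<lbrakk>less_tm \<cdot> (l \<cdot> (q \<cdot> zero (NatT \<rightarrow> X))) \<cdot> n\<rbrakk> = \<lbrakk>Con TrueC\<rbrakk>"
  shows "\<lbrakk>eps X R l n e q\<rbrakk> = \<lbrakk>zero (NatT \<rightarrow> X)\<rbrakk>"
  using cl_eps[OF assms(1,2)] assms by simp

lemma (in eps_model) cl_eps_continue:
  assumes "typeof \<Gamma> n = Some NatT" "typeof \<Gamma> q = Some ((NatT \<rightarrow> X) \<rightarrow> R)"
    and "\<lbrakk>less_tm \<cdot> (l \<cdot> (q \<cdot> zero (NatT \<rightarrow> X))) \<cdot> n\<rbrakk> = \<lbrakk>Con FalseC\<rbrakk>"
  defines "c \<equiv> e \<cdot> n \<cdot> eps_continuation X R l n e q"
  shows "\<lbrakk>eps X R l n e q\<rbrakk> =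
    \<lbrakk>prepend X \<cdot> c \<cdot> eps X R l (Con SuccC \<cdot> n) e (section_tm X R \<cdot> q \<cdot> c)\<rbrakk>"
  using cl_eps[OF assms(1,2)] assms by simp

text \<open>The induction step of \<open>cl_eps_sections\<close>, for a given value \<open>v\<close>
  of the stopping test at stage \<open>n\<close>. Unfolding \<open>eps\<close> in the hypothesis
  \<open>IH\<close> determines the tail of \<open>a\<close> from \<open>n\<close>, and with it both
  \<open>a n\<close> and the tail from \<open>n + 1\<close>.\<close>

lemma (in eps_model) cl_eps_step:
  assumes n: "typeof \<Gamma> n = Some NatT" and q: "typeof \<Gamma> q = Some ((NatT \<rightarrow> X) \<rightarrow> R)"
    and a: "typeof \<Gamma> a = Some (NatT \<rightarrow> X)"
    and IH: "\<lbrakk>eps X R l n e q\<rbrakk> = \<lbrakk>shift_tm X \<cdot> a \<cdot> n\<rbrakk>"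
    and v: "v = TrueC \<or> v = FalseC"
      "\<lbrakk>less_tm \<cdot> (l \<cdot> (q \<cdot> zero (NatT \<rightarrow> X))) \<cdot> n\<rbrakk> = \<lbrakk>Con v\<rbrakk>"
  shows "\<lbrakk>eps X R l (Con SuccC \<cdot> n) e (section_tm X R \<cdot> q \<cdot> (a \<cdot> n))\<rbrakk> =
    \<lbrakk>shift_tm X \<cdot> a \<cdot> (Con SuccC \<cdot> n)\<rbrakk>"
  using v(1)
proof
  note ty [simp] = n q a
  have an: "\<lbrakk>a\<rbrakk> \<bullet> \<lbrakk>n\<rbrakk> = \<lbrakk>shift_tm X \<cdot> a \<cdot> n\<rbrakk> \<bullet> \<lbrakk>Con ZeroC\<rbrakk>" by simp
  have tail: "\<lbrakk>shift_tm X \<cdot> a \<cdot> (Con SuccC \<cdot> n)\<rbrakk> = \<lbrakk>tail_tm X\<rbrakk> \<bullet> \<lbrakk>shift_tm X \<cdot> a \<cdot> n\<rbrakk>"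
    by (simp add: cl_tail_shift)
  {
    assume [simp]: "v = TrueC"
    have 0: "\<lbrakk>shift_tm X \<cdot> a \<cdot> n\<rbrakk> = \<lbrakk>zero (NatT \<rightarrow> X)\<rbrakk>"
      using IH cl_eps_stop[OF n q] v(2) by (simp del: cl_app zero.simps)
    have 1: "\<lbrakk>shift_tm X \<cdot> a \<cdot> (Con SuccC \<cdot> n)\<rbrakk> = \<lbrakk>zero (NatT \<rightarrow> X)\<rbrakk>"
      by (simp only: tail 0 cl_tail_zero)
    \<comment> \<open>The test at stage \<open>n + 1\<close> looks at the same value: prepending
      \<open>a n\<close> to the zero tail from \<open>n + 1\<close> gives the tail from
      \<open>n\<close>, which is zero too.\<close>
    have "\<lbrakk>section_tm X R \<cdot> q \<cdot> (a \<cdot> n) \<cdot> zero (NatT \<rightarrow> X)\<rbrakk>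
        = \<lbrakk>section_tm X R \<cdot> q \<cdot> (a \<cdot> n)\<rbrakk> \<bullet> \<lbrakk>shift_tm X \<cdot> a \<cdot> (Con SuccC \<cdot> n)\<rbrakk>"
      unfolding 1 by (simp only: cl_app)
    also have "\<dots> = \<lbrakk>q\<rbrakk> \<bullet> \<lbrakk>shift_tm X \<cdot> a \<cdot> n\<rbrakk>" by (simp add: cl_prepend_shift)
    also have "\<dots> = \<lbrakk>q \<cdot> zero (NatT \<rightarrow> X)\<rbrakk>" unfolding 0 by (simp only: cl_app)
    finally have "\<lbrakk>section_tm X R \<cdot> q \<cdot> (a \<cdot> n) \<cdot> zero (NatT \<rightarrow> X)\<rbrakk> = \<lbrakk>q \<cdot> zero (NatT \<rightarrow> X)\<rbrakk>" .
    moreover have "\<lbrakk>less_tm \<cdot> (l \<cdot> (q \<cdot> zero (NatT \<rightarrow> X))) \<cdot> (Con SuccC \<cdot> n)\<rbrakk> = \<lbrakk>Con TrueC\<rbrakk>"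
      using v(2) by (simp add: cl_less_SucI)
    ultimately have "\<lbrakk>less_tm \<cdot> (l \<cdot> (section_tm X R \<cdot> q \<cdot> (a \<cdot> n) \<cdot> zero (NatT \<rightarrow> X)))
        \<cdot> (Con SuccC \<cdot> n)\<rbrakk> = \<lbrakk>Con TrueC\<rbrakk>"
      by (metis cl_app)
    then show ?thesis by (subst cl_eps_stop) (simp_all del: cl_app zero.simps add: 1)
  next
    assume [simp]: "v = FalseC"
    define c where "c = e \<cdot> n \<cdot> eps_continuation X R l n e q"
    have c: "typeof \<Gamma> c = Some X" by (simp add: c_def)
    have 0: "\<lbrakk>shift_tm X \<cdot> a \<cdot> n\<rbrakk> =
        \<lbrakk>prepend X \<cdot> c \<cdot> eps X R l (Con SuccC \<cdot> n) e (section_tm X R \<cdot> q \<cdot> c)\<rbrakk>"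
      using IH cl_eps_continue[OF n q] v(2) by (simp del: cl_app zero.simps add: c_def)
    \<comment> \<open>First entries agree, so \<open>eps\<close> has chosen \<open>a n\<close>; the
      section at \<open>c\<close> is the section at \<open>a n\<close>, and taking tails
      finishes.\<close>
    have an': "\<lbrakk>a\<rbrakk> \<bullet> \<lbrakk>n\<rbrakk> = \<lbrakk>c\<rbrakk>" unfolding an 0 by (simp add: c)
    show ?thesis unfolding tail 0 by (simp add: c cl_tail_prepend an')
  }
qed

lemma (in eps_model) cl_eps_sections:
  assumes n: "typeof \<Gamma> n = Some NatT" and q: "typeof \<Gamma> q = Some ((NatT \<rightarrow> X) \<rightarrow> R)"
  defines "a \<equiv> eps X R l (Con ZeroC) e q"
  shows "\<lbrakk>eps X R l n e (sections_tm X R \<cdot> a \<cdot> q \<cdot> n)\<rbrakk> = \<lbrakk>shift_tm X \<cdot> a \<cdot> n\<rbrakk>"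
proof -
  have a: "typeof \<Gamma> a = Some (NatT \<rightarrow> X)" using q by (simp add: a_def)
  let ?Q = "sections_tm X R \<cdot> lift a \<cdot> lift q"
  let ?s = "eps X R (lift l) (Var 0) (lift e) (?Q \<cdot> Var 0)" and ?t = "shift_tm X \<cdot> lift a \<cdot> Var 0"
  let ?\<theta> = "case_nat (Con SuccC \<cdot> Var 0) (\<lambda>i. Var (Suc i))"
  have "\<lbrakk>inst n ?s\<rbrakk> = \<lbrakk>inst n ?t\<rbrakk>"
  proof (rule cl_nat_induct[where \<tau> = "NatT \<rightarrow> X"])
    show "\<lbrakk>inst (Con ZeroC) ?s\<rbrakk> = \<lbrakk>inst (Con ZeroC) ?t\<rbrakk>"
      using q a by (simp add: cl_shift_zero) (simp add: a_def)
  next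
    fix \<Delta>1
    assume IH: "Eq (NatT \<rightarrow> X) ?s ?t \<in> set \<Delta>1"
    show "cl T (NatT # \<Gamma>) \<Delta>1 (subst ?\<theta> ?s) = cl T (NatT # \<Gamma>) \<Delta>1 (subst ?\<theta> ?t)"
    \<comment> \<open>The distinction is whether \<open>eps\<close> stops at stage
      \<open>n\<close>.\<close>
    proof (rule term_model.cl_bool_cases[where \<tau> = "NatT \<rightarrow> X"
          and b = "less_tm \<cdot> (lift l \<cdot> (?Q \<cdot> Var 0 \<cdot> zero (NatT \<rightarrow> X))) \<cdot> Var 0"])
      fix v \<Delta>2
      assume v: "v = TrueC \<or> v = FalseC" "set \<Delta>1 \<subseteq> set \<Delta>2"
        "cl T (NatT # \<Gamma>) \<Delta>2 (less_tm \<cdot> (lift l \<cdot> (?Q \<cdot> Var 0 \<cdot> zero (NatT \<rightarrow> X))) \<cdot> Var 0)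
          = cl T (NatT # \<Gamma>) \<Delta>2 (Con v)"
      \<comment> \<open>The induction variable has entered the context, so the facts on
        \<open>eps\<close> are needed for the lifted parameters.\<close>
      interpret ext: eps_model T "NatT # \<Gamma>" \<Delta>2 X R "lift l" "lift e"
        by unfold_locales (simp_all add: axioms)
      have "cl T (NatT # \<Gamma>) \<Delta>2 ?s = cl T (NatT # \<Gamma>) \<Delta>2 ?t"
        using IH v(2) q a by (intro term_model.cl_asm[where \<tau> = "NatT \<rightarrow> X"]) auto
      from ext.cl_eps_step[OF _ _ _ this v(1,3)] q a
      show "cl T (NatT # \<Gamma>) \<Delta>2 (subst ?\<theta> ?s) = cl T (NatT # \<Gamma>) \<Delta>2 (subst ?\<theta> ?t)"
        by simp
    qed (use q a in simp_all)
  qed (use n q a in simp_all)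
  then show ?thesis by simp
qed


text \<open>No contradiction is derived. If the test is true, the tail of \<open>a\<close> from
  \<open>n\<close> is zero, so the section at stage \<open>n\<close> maps zero to
  \<open>q a\<close>. The test then compares \<open>n\<close> with itself and is false as
  well.\<close>

lemma (in eps_model) cl_not_stopped:
  assumes n: "typeof \<Gamma> n = Some NatT" and q: "typeof \<Gamma> q = Some ((NatT \<rightarrow> X) \<rightarrow> R)"
    and v: "v = TrueC \<or> v = FalseC"
  defines "a \<equiv> eps X R l (Con ZeroC) e q"
  defines "b \<equiv> less_tm \<cdot> (l \<cdot> (sections_tm X R \<cdot> a \<cdot> q \<cdot> n \<cdot> zero (NatT \<rightarrow> X))) \<cdot> n"
  assumes l: "\<lbrakk>l \<cdot> (q \<cdot> a)\<rbrakk> = \<lbrakk>n\<rbrakk>" and b: "\<lbrakk>b\<rbrakk> = \<lbrakk>Con v\<rbrakk>"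
  shows "\<lbrakk>b\<rbrakk> = \<lbrakk>Con FalseC\<rbrakk>"
  using v
proof
  assume [simp]: "v = TrueC"
  let ?Q = "sections_tm X R \<cdot> a \<cdot> q \<cdot> n"
  have a: "typeof \<Gamma> a = Some (NatT \<rightarrow> X)" using q by (simp add: a_def)
  have "\<lbrakk>eps X R l n e ?Q\<rbrakk> = \<lbrakk>zero (NatT \<rightarrow> X)\<rbrakk>"
    by (rule cl_eps_stop) (use n q a b in \<open>simp_all del: cl_app zero.simps add: b_def\<close>)
  then have "\<lbrakk>zero (NatT \<rightarrow> X)\<rbrakk> = \<lbrakk>shift_tm X \<cdot> a \<cdot> n\<rbrakk>"
    using cl_eps_sections[OF n q] unfolding a_def by metis
  then have "\<lbrakk>?Q \<cdot> zero (NatT \<rightarrow> X)\<rbrakk> = \<lbrakk>?Q \<cdot> (shift_tm X \<cdot> a \<cdot> n)\<rbrakk>"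
    by (simp only: cl_app)
  also have "\<dots> = \<lbrakk>q \<cdot> a\<rbrakk>" using n q a by (simp add: cl_sections_shift)
  finally have "\<lbrakk>l \<cdot> (?Q \<cdot> zero (NatT \<rightarrow> X))\<rbrakk> = \<lbrakk>n\<rbrakk>"
    using l by (metis cl_app)
  then have "\<lbrakk>b\<rbrakk> = \<lbrakk>less_tm\<rbrakk> \<bullet> \<lbrakk>n\<rbrakk> \<bullet> \<lbrakk>n\<rbrakk>" unfolding b_def by (metis cl_app)
  then show ?thesis using n by (simp add: cl_less_self)
qed (use b in simp)


section \<open>Spector's equations\<close>

lemma (in term_model) spector_solution:
  fixes X R :: ty and q w e :: tm
  assumes axioms: "eps_axioms \<subseteq> T"
    and ty [simp]: "typeof \<Gamma> q = Some ((NatT \<rightarrow> X) \<rightarrow> R)" "typeof \<Gamma> w = Some ((NatT \<rightarrow> X) \<rightarrow> NatT)"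
      "typeof \<Gamma> e = Some (NatT \<rightarrow> J R X)"
  obtains n a p where "typeof \<Gamma> n = Some NatT" "typeof \<Gamma> a = Some (NatT \<rightarrow> X)"
    "typeof \<Gamma> p = Some (X \<rightarrow> R)" "\<lbrakk>n\<rbrakk> = \<lbrakk>w \<cdot> a\<rbrakk>" "\<lbrakk>a \<cdot> n\<rbrakk> = \<lbrakk>e \<cdot> n \<cdot> p\<rbrakk>" "\<lbrakk>p \<cdot> (a \<cdot> n)\<rbrakk> = \<lbrakk>q \<cdot> a\<rbrakk>"
proof -
  let ?R = "ProdT R NatT"
  define q' where "q' = Lam (NatT \<rightarrow> X) (Con (PairC R NatT) \<cdot> (lift q \<cdot> Var 0) \<cdot> (lift w \<cdot> Var 0))"
  define e' where "e' = Lam NatT (Lam (X \<rightarrow> ?R)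
    (lift (lift e) \<cdot> Var 1 \<cdot> Lam X (Con (FstC R NatT) \<cdot> (Var 1 \<cdot> Var 0))))"
  define l where "l = Con (SndC R NatT)"
  have q' [simp]: "typeof \<Gamma> q' = Some ((NatT \<rightarrow> X) \<rightarrow> ?R)" by (simp add: q'_def)
  interpret eps_model T \<Gamma> \<Delta> X ?R l e'
    by unfold_locales (simp_all add: axioms e'_def l_def)
  define a where "a = eps X ?R l (Con ZeroC) e' q'"
  have a [simp]: "typeof \<Gamma> a = Some (NatT \<rightarrow> X)" by (simp add: a_def)
  define n where "n = w \<cdot> a"
  have n [simp]: "typeof \<Gamma> n = Some NatT" by (simp add: n_def)
  define Q where "Q = sections_tm X ?R \<cdot> a \<cdot> q' \<cdot> n"
  have Q [simp]: "typeof \<Gamma> Q = Some ((NatT \<rightarrow> X) \<rightarrow> ?R)" by (simp add: Q_def)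
  define P where "P = eps_continuation X ?R l n e' Q"
  have P [simp]: "typeof \<Gamma> P = Some (X \<rightarrow> ?R)" by (simp add: P_def)
  define p where "p = Lam X (Con (FstC R NatT) \<cdot> (lift P \<cdot> Var 0))"
  have p [simp]: "typeof \<Gamma> p = Some (X \<rightarrow> R)" by (simp add: p_def)
  have sh: "\<lbrakk>eps X ?R l n e' Q\<rbrakk> = \<lbrakk>shift_tm X \<cdot> a \<cdot> n\<rbrakk>"
    using cl_eps_sections[OF n q'] by (simp only: a_def Q_def)
  have Qsh: "\<lbrakk>Q \<cdot> (shift_tm X \<cdot> a \<cdot> n)\<rbrakk> = \<lbrakk>q' \<cdot> a\<rbrakk>"
    by (simp add: Q_def cl_sections_shift)
  have w: "\<lbrakk>l \<cdot> (q' \<cdot> a)\<rbrakk> = \<lbrakk>n\<rbrakk>" by (simp add: q'_def l_def n_def)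
  have less: "\<lbrakk>less_tm \<cdot> (l \<cdot> (Q \<cdot> zero (NatT \<rightarrow> X))) \<cdot> n\<rbrakk> = \<lbrakk>Con FalseC\<rbrakk>" (is "\<lbrakk>?b\<rbrakk> = _")
  \<comment> \<open>Both possible values of the test lead to false by \<open>cl_not_stopped\<close>.
    Its premise on \<open>l\<close> is established again for the extended assumptions.\<close>
  proof (rule cl_bool_cases[where b = ?b and \<tau> = BoolT])
    fix v \<Delta>'
    assume v: "v = TrueC \<or> v = FalseC" "cl T \<Gamma> \<Delta>' ?b = cl T \<Gamma> \<Delta>' (Con v)"
    show "cl T \<Gamma> \<Delta>' ?b = cl T \<Gamma> \<Delta>' (Con FalseC)"
    proof -
      interpret ext: eps_model T \<Gamma> \<Delta>' X ?R l e'
        by unfold_locales (simp_all add: axioms e'_def l_def)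
      have "cl T \<Gamma> \<Delta>' (l \<cdot> (q' \<cdot> a)) = cl T \<Gamma> \<Delta>' n"
        by (simp add: q'_def l_def n_def)
      from ext.cl_not_stopped[OF n q' v(1), folded a_def Q_def, OF this v(2)] show ?thesis .
    qed
  qed simp_all
  define c where "c = e' \<cdot> n \<cdot> P"
  have c [simp]: "typeof \<Gamma> c = Some X" by (simp add: c_def)
  have pre: "\<lbrakk>shift_tm X \<cdot> a \<cdot> n\<rbrakk> =
      \<lbrakk>prepend X \<cdot> c \<cdot> eps X ?R l (Con SuccC \<cdot> n) e' (section_tm X ?R \<cdot> Q \<cdot> c)\<rbrakk>"
    using cl_eps_continue[OF n Q less] sh by (simp add: c_def P_def)
  \<comment> \<open>The tail from \<open>n\<close> begins with \<open>a n\<close>, its unfolding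
    with \<open>c\<close>.\<close>
  have "\<lbrakk>a \<cdot> n\<rbrakk> = \<lbrakk>shift_tm X \<cdot> a \<cdot> n\<rbrakk> \<bullet> \<lbrakk>Con ZeroC\<rbrakk>" by simp
  also have "\<dots> = \<lbrakk>c\<rbrakk>" unfolding pre by simp
  finally have an: "\<lbrakk>a \<cdot> n\<rbrakk> = \<lbrakk>c\<rbrakk>" .
  also have "\<lbrakk>c\<rbrakk> = \<lbrakk>e \<cdot> n \<cdot> p\<rbrakk>"
  proof -
    let ?F = "Con (FstC R NatT)"
    \<comment> \<open>\<open>cl_beta\<close> would leave an arbitrary representative of the class of
      \<open>P\<close> under the inner abstraction, where \<open>p\<close> has \<open>P\<close>
      itself.\<close>
    have "\<lbrakk>e' \<cdot> n\<rbrakk> = \<lbrakk>inst n (Lam (X \<rightarrow> ?R) (lift (lift e) \<cdot> Var 1 \<cdot> Lam X (?F \<cdot> (Var 1 \<cdot> Var 0))))\<rbrakk>"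
      unfolding e'_def by (rule cl_beta_inst) simp_all
    then have "\<lbrakk>c\<rbrakk> = \<lbrakk>Lam (X \<rightarrow> ?R) (lift e \<cdot> lift n \<cdot> Lam X (?F \<cdot> (Var 1 \<cdot> Var 0))) \<cdot> P\<rbrakk>"
      by (simp del: cl_app cl_beta add: c_def cl_app[of _ _ _ _ P])
    also have "\<dots> = \<lbrakk>inst P (lift e \<cdot> lift n \<cdot> Lam X (?F \<cdot> (Var 1 \<cdot> Var 0)))\<rbrakk>"
      by (rule cl_beta_inst) simp_all
    finally show ?thesis by (simp add: p_def)
  qed
  finally have "\<lbrakk>a \<cdot> n\<rbrakk> = \<lbrakk>e \<cdot> n \<cdot> p\<rbrakk>" .
  moreover have "\<lbrakk>p \<cdot> (a \<cdot> n)\<rbrakk> = \<lbrakk>q \<cdot> a\<rbrakk>"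
  proof -
    \<comment> \<open>Evaluating the continuation at the chosen \<open>c\<close> rebuilds exactly
      the unfolding of \<open>eps\<close> at stage \<open>n\<close>, hence the tail of
      \<open>a\<close> from \<open>n\<close>.\<close>
    have "\<lbrakk>P \<cdot> c\<rbrakk> =
        \<lbrakk>Q\<rbrakk> \<bullet> \<lbrakk>prepend X \<cdot> c \<cdot> eps X ?R l (Con SuccC \<cdot> n) e' (section_tm X ?R \<cdot> Q \<cdot> c)\<rbrakk>"
      by (simp add: P_def eps_continuation_def)
    also have "\<dots> = \<lbrakk>q' \<cdot> a\<rbrakk>" unfolding pre[symmetric] Qsh[symmetric] by simp
    finally have "\<lbrakk>P \<cdot> c\<rbrakk> = \<lbrakk>q' \<cdot> a\<rbrakk>" .
    then have "\<lbrakk>p \<cdot> c\<rbrakk> = \<lbrakk>Con (FstC R NatT) \<cdot> (q' \<cdot> a)\<rbrakk>" by (simp add: p_def)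
    also have "\<dots> = \<lbrakk>q \<cdot> a\<rbrakk>" by (simp add: q'_def)
    finally show ?thesis using an by (metis cl_app)
  qed
  ultimately show ?thesis using that[of n a p] by (simp add: n_def)
qed

theorem corollary3p9:
  fixes X R :: ty
  shows "HA eps_axioms [] []
    (Forall ((NatT \<rightarrow> X) \<rightarrow> R) (Forall ((NatT \<rightarrow> X) \<rightarrow> NatT) (Forall (NatT \<rightarrow> J R X)
      (Exists NatT (Exists (NatT \<rightarrow> X) (Exists (X \<rightarrow> R)
        (let q = Var 5; \<omega> = Var 4; \<epsilon> = Var 3; n = Var 2; \<alpha> = Var 1; p = Var 0
         in And (Eq NatT n (\<omega> \<cdot> \<alpha>))
           (And (Eq X (\<alpha> \<cdot> n) (\<epsilon> \<cdot> n \<cdot> p))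
                (Eq R (p \<cdot> (\<alpha> \<cdot> n)) (q \<cdot> \<alpha>))))))))))"
proof -
  \<comment> \<open>The innermost quantifier comes first: index 0 is the sequence of selection
    functions, 1 is \<open>\<omega>\<close> and 2 is \<open>q\<close>.\<close>
  let ?\<Gamma> = "[NatT \<rightarrow> J R X, (NatT \<rightarrow> X) \<rightarrow> NatT, (NatT \<rightarrow> X) \<rightarrow> R]"
  obtain n a p where ty: "typeof ?\<Gamma> n = Some NatT" "typeof ?\<Gamma> a = Some (NatT \<rightarrow> X)"
      "typeof ?\<Gamma> p = Some (X \<rightarrow> R)"
    and eqs: "cl eps_axioms ?\<Gamma> [] n = cl eps_axioms ?\<Gamma> [] (Var 1 \<cdot> a)"
      "cl eps_axioms ?\<Gamma> [] (a \<cdot> n) = cl eps_axioms ?\<Gamma> [] (Var 0 \<cdot> n \<cdot> p)"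
      "cl eps_axioms ?\<Gamma> [] (p \<cdot> (a \<cdot> n)) = cl eps_axioms ?\<Gamma> [] (Var 2 \<cdot> a)"
    by (rule term_model.spector_solution[of eps_axioms ?\<Gamma> "Var 2" X R "Var 1" "Var 0" "[]"])
      (simp_all del: cl_app)
  let ?\<phi> = "\<lambda>q w e n a p. And (Eq NatT n (w \<cdot> a))
    (And (Eq X (a \<cdot> n) (e \<cdot> n \<cdot> p)) (Eq R (p \<cdot> (a \<cdot> n)) (q \<cdot> a)))"
  have "HA eps_axioms ?\<Gamma> [] (?\<phi> (Var 2) (Var 1) (Var 0) n a p)"
    using ty by (intro HA.andI HA_Eq_if_cl_eq eqs) simp_all
  \<comment> \<open>The existential quantifiers are introduced from the inside out; the witnesses
    still to be abstracted are lifted past each new binder.\<close>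
  then have "HA eps_axioms ?\<Gamma> [] (Exists (X \<rightarrow> R)
      (?\<phi> (Var 3) (Var 2) (Var 1) (lift n) (lift a) (Var 0)))"
    using ty by - (rule HA.exI[where t = p], simp_all add: numeral_eq_Suc)
  then have "HA eps_axioms ?\<Gamma> [] (Exists (NatT \<rightarrow> X) (Exists (X \<rightarrow> R)
      (?\<phi> (Var 4) (Var 3) (Var 2) (lift (lift n)) (Var 1) (Var 0))))"
    using ty by - (rule HA.exI[where t = a], simp_all add: numeral_eq_Suc)
  then have "HA eps_axioms ?\<Gamma> [] (Exists NatT (Exists (NatT \<rightarrow> X) (Exists (X \<rightarrow> R)
      (?\<phi> (Var 5) (Var 4) (Var 3) (Var 2) (Var 1) (Var 0)))))"
    using ty by - (rule HA.exI[where t = n], simp_all add: numeral_eq_Suc)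
  then show ?thesis
    unfolding Let_def by (intro HA.allI) simp
qed

end
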